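(* Let $\Pi$ be a stationary random partition of $\mathbb N$, with blocks arranged in increasing order of their least elements. Then the blocks possess asymptotic frequencies: almost surely, for every $i\ge 1$ the limit $F_i=\lim_{n\to\infty} F_{i,n}$ exists, where $F_{i,n}$ is $n^{-1}$ times the number of elements of $[n]$ belonging to the $i$th block (with $F_{i,n}=0$ if there is no $i$th block). Moreover, conditionally on the random probability measure $$\nu=\sum_{i=1}^\infty F_i\,\delta_{F_i}+\Bigl(1-\sum_{i=1}^\infty F_i\Bigr)\delta_0$$ on $[0,1]$, the frequency $F_1$ of the first block has distribution $\nu$.
   Context: $[n]=\{1,\dots,n\}$. A random partition $\Pi$ of $\mathbb N=\{1,2,\dots\}$ is a random variable with values in the set of all partitions of $\mathbb N$, identified with consistent sequences of their restrictions to $[n]$, $n\ge1$, with the $\sigma$-algebra generated by these restrictions. $\Pi$ is stationary if $\Pi\stackrel{d}{=}\Pi|_{\mathbb N\setminus\{1\}}$, where partitions of $\mathbb N\setminus\{1\}$ are identified with partitions of $\mathbb N$ via the increasing bijection $i+1\mapsto i$. The measure $\nu$ is called the unordered frequency distribution; $\delta_x$ denotes the unit mass at $x$. *)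

theory Defs
  imports "HOL-Probability.Probability"
begin

definition partitions :: "nat set set set" where
  "partitions = {P. partition_on {1..} P}"

definition restrict_partition :: "nat set \<Rightarrow> nat set set \<Rightarrow> nat set set" where
  "restrict_partition A P = (\<lambda>B. B \<inter> A) ` P - {{}}"

definition partition_space :: "nat set set measure" where
  "partition_space = sigma partitions
     {restrict_partition {1..n} -` X \<inter> partitions |n X. n \<ge> 1}"

definition delete_first :: "nat set set \<Rightarrow> nat set set" where
  "delete_first P = (`) (\<lambda>i. i - 1) ` restrict_partition ({1..} - {1}) P"

definition random_partition :: "'w measure \<Rightarrow> ('w \<Rightarrow> nat set set) \<Rightarrow> bool" where
  "random_partition M \<pi> \<longleftrightarrow> prob_space M \<and> \<pi> \<in> M \<rightarrow>\<^sub>M partition_space"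

definition stationary_partition :: "'w measure \<Rightarrow> ('w \<Rightarrow> nat set set) \<Rightarrow> bool" where
  "stationary_partition M \<pi> \<longleftrightarrow>
     distr M partition_space \<pi> = distr M partition_space (\<lambda>\<omega>. delete_first (\<pi> \<omega>))"

(* B is the i-th block iff exactly i blocks have least element at most Inf B;
   the union below is over at most one block, and is empty if there are fewer than i blocks
   or if i = 0. *)
definition block :: "nat set set \<Rightarrow> nat \<Rightarrow> nat set" where
  "block P i = \<Union>{B \<in> P. card {C \<in> P. Inf C \<le> Inf B} = i}"

definition rel_freq :: "nat set set \<Rightarrow> nat \<Rightarrow> nat \<Rightarrow> real" where
  "rel_freq P i n = real (card (block P i \<inter> {1..n})) / real n"

(* The value 0 where the limit does not exist is only a convention on a null set: it makes
   every freq P i lie in {0..1}, with sum over i at most 1, for all partitions P. *)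
definition freq :: "nat set set \<Rightarrow> nat \<Rightarrow> real" where
  "freq P i = (if convergent (rel_freq P i) then lim (rel_freq P i) else 0)"

abbreviation unit_interval :: "real measure" where
  "unit_interval \<equiv> restrict_space borel {0..1}"

(* Blocks are numbered from 1, hence the Suc; return unit_interval x is the unit mass at x. *)
definition unordered_freq_dist :: "nat set set \<Rightarrow> real measure" where
  "unordered_freq_dist P = measure_of {0..1} (sets unit_interval)
     (\<lambda>A. (\<Sum>i. ennreal (freq P (Suc i)) * emeasure (return unit_interval (freq P (Suc i))) A)
        + ennreal (1 - (\<Sum>i. freq P (Suc i))) * emeasure (return unit_interval 0) A)"

(* Conditionally on the random probability measure \<mu> on S, the S-valued random variable X has
   distribution \<mu>.  The conditioning sigma-algebra is the one generated by \<mu>, i.e. by the maps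
   \<omega> \<mapsto> \<mu> \<omega> (A) with A measurable. *)
definition conditionally_distributed ::
    "'w measure \<Rightarrow> 'a measure \<Rightarrow> ('w \<Rightarrow> 'a measure) \<Rightarrow> ('w \<Rightarrow> 'a) \<Rightarrow> bool" where
  "conditionally_distributed M S \<mu> X \<longleftrightarrow>
     \<mu> \<in> M \<rightarrow>\<^sub>M prob_algebra S \<and> X \<in> M \<rightarrow>\<^sub>M S \<and>
     (\<forall>A \<in> sets S. AE \<omega> in M.
        real_cond_exp M (vimage_algebra (space M) \<mu> (prob_algebra S))
          (indicator (X -` A \<inter> space M)) \<omega> = measure (\<mu> \<omega>) A)"

end

theory Submission
  imports Defs
begin

text \<open>No ergodic theorem is needed for the existence of the frequencies. Suppose that the relative
  frequency of the block \<open>C\<close> of 1 drops below \<open>p\<close> and exceeds \<open>q > p\<close> infinitely often, and let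
  \<open>p < a < q\<close>. From every point \<open>i\<close> of \<open>C\<close> starts a window in which \<open>C\<close> has density below \<open>a\<close>; call
  \<open>i\<close> \<open>K\<close>-bad if no such window has length at most \<open>K\<close>. Jumping over short windows from points of
  \<open>C\<close> that are not bad, and by single steps otherwise, bounds the number of elements of \<open>C\<close> in \<open>[n]\<close>
  by \<open>a n + K\<close> plus the number of bad points (steps outside \<open>C\<close> cost nothing), so in some \<open>[n]\<close> the
  bad points have density at least \<open>(q - a) / 2\<close>. By the maximal inequality this has probability at
  most \<open>2 P(1 is K-bad) / (q - a)\<close>, which tends to 0 as \<open>K\<close> grows.

  For the conditional law, \<open>\<nu>\<close> is invariant under deletion of 1, so the block of 1 may be replaced
  by the block of a uniformly chosen element of \<open>[n]\<close>. For \<open>A\<close> bounded away from 0 only finitely many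
  blocks have frequency in \<open>A\<close>, and the proportion of \<open>[n]\<close> that they cover tends to \<open>\<nu>(A)\<close>.\<close>

section \<open>Covering arguments and the maximal inequality\<close>

text \<open>Greedy covering: on the walk up from \<open>s\<close>, a marked point is jumped over
  together with its window. A window of length \<open>n\<close> contains at most \<open>n\<close>
  marked points and pays for them with \<open>c * n\<close> points of \<open>e\<close>. The windows
  used are disjoint, and the last one overruns \<open>L\<close> by less than
  \<open>R\<close>.\<close>

lemma card_hits_covering:
  fixes c :: real and e m :: "nat \<Rightarrow> bool"
  assumes c: "0 \<le> c"
    and cover: "\<And>i. m i \<Longrightarrow> \<exists>n\<in>{1..R}. c * real n \<le> real (card {j\<in>{i..<i+n}. e j})"
  shows "c * real (card {i\<in>{s..<L}. m i}) \<le> real (card {j\<in>{s..<L+R}. e j})"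
proof (induction "L - s" arbitrary: s rule: less_induct)
  case less
  show ?case
  proof (cases "s < L")
    case False
    then show ?thesis by simp
  next
    case sL: True
    show ?thesis
    proof (cases "m s")
      case False
      then have "{i\<in>{s..<L}. m i} = {i\<in>{Suc s..<L}. m i}"
        by (auto simp: Suc_le_eq order_less_le)
      moreover have "card {j\<in>{Suc s..<L+R}. e j} \<le> card {j\<in>{s..<L+R}. e j}"
        by (intro card_mono) auto
      ultimately show ?thesis
        using less.hyps[of "Suc s"] sL by fastforce
    next
      case True
      from cover[OF this] obtain n where n: "1 \<le> n" "n \<le> R"
        and hits: "c * real n \<le> real (card {j\<in>{s..<s+n}. e j})" by auto
      have "{i\<in>{s..<L}. m i} \<subseteq> {s..<s+n} \<union> {i\<in>{s+n..<L}. m i}" by auto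
      then have "card {i\<in>{s..<L}. m i} \<le> n + card {i\<in>{s+n..<L}. m i}"
        using card_mono[of "{s..<s+n} \<union> {i\<in>{s+n..<L}. m i}"] card_Un_le[of "{s..<s+n}" "{i\<in>{s+n..<L}. m i}"]
        by (auto intro: order_trans)
      then have "c * real (card {i\<in>{s..<L}. m i}) \<le> c * real n + c * real (card {i\<in>{s+n..<L}. m i})"
        using c by (metis distrib_left mult_left_mono of_nat_add of_nat_mono)
      also have "\<dots> \<le> real (card {j\<in>{s..<s+n}. e j}) + real (card {j\<in>{s+n..<L+R}. e j})"
        using hits less.hyps[of "s+n"] sL n by (intro add_mono) auto
      also have "\<dots> = real (card ({j\<in>{s..<s+n}. e j} \<union> {j\<in>{s+n..<L+R}. e j}))"
        by (subst card_Un_disjoint) auto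
      also have "{j\<in>{s..<s+n}. e j} \<union> {j\<in>{s+n..<L+R}. e j} = {j\<in>{s..<L+R}. e j}"
        using n sL by auto
      finally show ?thesis .
    qed
  qed
qed

text \<open>Positions are counted from 0: standing at \<open>i\<close>, the walk inspects
  \<open>Suc i\<close> next. Each step costs at most \<open>a\<close> times its length, except at
  bad points, which are counted separately, and for a last window overrunning the end, which costs
  at most \<open>K\<close>.\<close>

lemma card_le_light_windows:
  fixes a :: real and C :: "nat set"
  assumes a: "0 \<le> a"
  shows "real (card (C \<inter> {s+1..s+l})) \<le> a * real l + real K +
    real (card {i\<in>{s..<s+l}. Suc i \<in> C \<and> (\<forall>n\<in>{1..K}. a * real n \<le> real (card (C \<inter> {i+1..i+n})))})"
    (is "_ \<le> _ + _ + real (card (?B s l))")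
proof (induction l arbitrary: s rule: less_induct)
  case (less l)
  show ?case
  proof (cases "l = 0")
    case True
    then show ?thesis by simp
  next
    case l: False
    have sub: "card (?B (s+n) (l-n)) \<le> card (?B s l)" if "n \<le> l" for n
      using that by (intro card_mono) auto
    have split: "card (C \<inter> {s+1..s+l}) = card (C \<inter> {s+1..s+n}) + card (C \<inter> {s+n+1..s+n+(l-n)})"
      if "n \<le> l" for n
    proof -
      have "C \<inter> {s+1..s+l} = (C \<inter> {s+1..s+n}) \<union> (C \<inter> {s+n+1..s+n+(l-n)})"
        using that by auto
      then show ?thesis by (simp only:) (rule card_Un_disjoint, auto)
    qed
    \<comment> \<open>A single step outside \<open>C\<close>, a single step onto a bad point, or a
      jump over a short light window.\<close>
    consider "Suc s \<notin> C" | "s \<in> ?B s l"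
      | n where "n \<in> {1..K}" "real (card (C \<inter> {s+1..s+n})) < a * real n"
    proof (cases "\<exists>n\<in>{1..K}. real (card (C \<inter> {s+1..s+n})) < a * real n")
      case False
      then have "\<forall>n\<in>{1..K}. a * real n \<le> real (card (C \<inter> {s+1..s+n}))" by (meson not_le)
      then show thesis using l that(1,2) by auto
    qed (use that(3) in blast)
    then show ?thesis
    proof cases
      case 1
      then have "card (C \<inter> {s+1..s+1}) = 0" by simp
      moreover have "a * real (l - 1) \<le> a * real l" using a by (intro mult_left_mono) auto
      ultimately show ?thesis
        using split[of 1] less.IH[of "l-1" "s+1"] sub[of 1] l by simp
    next
      case 2
      have "card (C \<inter> {s+1..s+1}) \<le> 1"
        using card_mono[of "{s+1}" "C \<inter> {s+1..s+1}"] by simp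
      moreover have "a * real (l - 1) \<le> a * real l" using a by (intro mult_left_mono) auto
      moreover have "card (insert s (?B (s+1) (l-1))) \<le> card (?B s l)"
        using 2 l by (intro card_mono) auto
      then have "Suc (card (?B (s+1) (l-1))) \<le> card (?B s l)"
        by (subst (asm) card_insert_disjoint) auto
      ultimately show ?thesis
        using split[of 1] less.IH[of "l-1" "s+1"] l by simp
    next
      case (3 n)
      show ?thesis
      proof (cases "n \<le> l")
        case True
        have "a * real l = a * real n + a * real (l - n)"
          using True by (simp add: algebra_simps of_nat_diff)
        then show ?thesis
          using split[OF True] less.IH[of "l-n" "s+n"] sub[OF True] 3 True by fastforce
      next
        \<comment> \<open>The window overruns the end, so fewer than \<open>K\<close> positions
          remain and the term \<open>K\<close> pays for all of them.\<close>
        case False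
        have "card (C \<inter> {s+1..s+l}) \<le> l"
          using card_mono[of "{s+1..s+l}" "C \<inter> {s+1..s+l}"] by simp
        moreover have "0 \<le> a * real l" using a by simp
        ultimately show ?thesis using False 3 by auto
      qed
    qed
  qed
qed

text \<open>Since the values lie in [0,1], liminf and limsup are finite, and without convergence
  they differ. Rational thresholds leave only countably many null events to discard, and
  \<open>0 \<le> p\<close> makes every \<open>a\<close> above \<open>p\<close> admissible in
  \<open>card_le_light_windows\<close>.\<close>

lemma not_convergent_oscillates:
  fixes x :: "nat \<Rightarrow> real"
  assumes "\<not> convergent x" and "\<And>n. x n \<in> {0..1}"
  obtains p q where "p \<in> \<rat>" "q \<in> \<rat>" "0 \<le> p" "p < q"
    "\<exists>\<^sub>F n in sequentially. x n < p" "\<exists>\<^sub>F n in sequentially. q < x n"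
proof -
  have "liminf (\<lambda>n. ereal (x n)) \<noteq> limsup (\<lambda>n. ereal (x n))"
  proof
    assume eq: "liminf (\<lambda>n. ereal (x n)) = limsup (\<lambda>n. ereal (x n))"
    have b: "0 \<le> liminf (\<lambda>n. ereal (x n))" "limsup (\<lambda>n. ereal (x n)) \<le> 1"
      using assms(2) by (auto intro!: Liminf_bounded Limsup_bounded)
    have "\<bar>liminf (\<lambda>n. ereal (x n))\<bar> \<noteq> \<infinity>" using b unfolding eq by auto
    then obtain r where r: "liminf (\<lambda>n. ereal (x n)) = ereal r" by auto
    then have "x \<longlonglongrightarrow> r"
      by (intro limsup_le_liminf_real) (simp_all add: eq[symmetric])
    then show False using assms(1) by (auto simp: convergent_def)
  qed
  then have lt: "liminf (\<lambda>n. ereal (x n)) < limsup (\<lambda>n. ereal (x n))"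
    using Liminf_le_Limsup[of sequentially] by (simp add: order_less_le)
  then obtain u where u: "liminf (\<lambda>n. ereal (x n)) < ereal u" "ereal u < limsup (\<lambda>n. ereal (x n))"
    using ereal_dense2 by blast
  obtain v where v: "ereal u < ereal v" "ereal v < limsup (\<lambda>n. ereal (x n))"
    using ereal_dense2[OF u(2)] by blast
  obtain p where p: "p \<in> \<rat>" "u < p" "p < v" using v(1) Rats_dense_in_real[of u v] by auto
  obtain q where q: "q \<in> \<rat>" "p < q" "q < v" using p(3) Rats_dense_in_real[of p v] by auto
  have "0 \<le> liminf (\<lambda>n. ereal (x n))" using assms(2) by (auto intro!: Liminf_bounded)
  then have "0 < ereal u" using u(1) by (rule le_less_trans)
  then have "0 \<le> p" using p(2) by simp
  moreover have "\<exists>\<^sub>F n in sequentially. x n < p"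
  proof -
    have "\<not> ereal p \<le> liminf (\<lambda>n. ereal (x n))"
      using u(1) p(2) by (metis ereal_less_eq(3) less_eq_real_def linorder_not_le order_trans)
    then show ?thesis
      using Liminf_bounded[of "ereal p" "\<lambda>n. ereal (x n)" sequentially]
      by (auto simp: frequently_def not_less)
  qed
  moreover have "\<exists>\<^sub>F n in sequentially. q < x n"
  proof -
    have "\<not> limsup (\<lambda>n. ereal (x n)) \<le> ereal q"
      using v(2) q(3) by (metis ereal_less_eq(3) less_eq_real_def linorder_not_le order_trans)
    then show ?thesis
      using Limsup_bounded[of "\<lambda>n. ereal (x n)" "ereal q" sequentially]
      by (auto simp: frequently_def not_less)
  qed
  ultimately show thesis using that p(1) q(1,2) by blast
qed

section \<open>Measure-preserving maps and visits to an event\<close>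

locale stationary_system = prob_space +
  fixes T :: "'a \<Rightarrow> 'a"
  assumes T_measurable [measurable]: "T \<in> M \<rightarrow>\<^sub>M M"
    and distr_T: "distr M M T = M"
begin

lemma funpow_T_measurable [measurable]: "T ^^ n \<in> M \<rightarrow>\<^sub>M M"
  by (induction n) (auto intro: measurable_comp[OF _ T_measurable])

lemma distr_funpow_T: "distr M M (T ^^ n) = M"
proof (induction n)
  case (Suc n)
  have "distr M M (T ^^ Suc n) = distr (distr M M (T ^^ n)) M T"
    by (subst distr_distr) auto
  then show ?case by (simp only: Suc distr_T)
qed (simp add: distr_id)

lemma AE_funpow_T:
  assumes "AE x in M. Q x"
  shows "AE x in M. Q ((T ^^ n) x)"
  by (rule AE_distrD[OF funpow_T_measurable]) (simp only: distr_funpow_T assms)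

lemma integral_funpow_T:
  fixes f :: "'a \<Rightarrow> real"
  assumes [measurable]: "f \<in> borel_measurable M"
  shows "(\<integral>x. f ((T ^^ n) x) \<partial>M) = (\<integral>x. f x \<partial>M)"
  using integral_distr[of "T ^^ n" M M f] by (simp add: distr_funpow_T)

lemma card_visits_eq_sum:
  "real (card {i\<in>{..<n}. (T ^^ i) x \<in> E}) = (\<Sum>i<n. indicator E ((T ^^ i) x))"
  by (simp add: indicator_def sum.If_cases Int_def)

lemma integrable_card_visits:
  assumes [measurable]: "E \<in> sets M"
  shows "integrable M (\<lambda>x. real (card {i\<in>{..<n}. (T ^^ i) x \<in> E}))"
  unfolding card_visits_eq_sum
  by (intro Bochner_Integration.integrable_sum integrable_const_bound[where B=1]) (auto simp: indicator_def)

lemma borel_measurable_card_visits [measurable]: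
  "E \<in> sets M \<Longrightarrow> (\<lambda>x. real (card {i\<in>{..<n}. (T ^^ i) x \<in> E})) \<in> borel_measurable M"
  by (rule borel_measurable_integrable[OF integrable_card_visits])

lemma integral_card_visits:
  assumes [measurable]: "E \<in> sets M"
  shows "(\<integral>x. real (card {i\<in>{..<n}. (T ^^ i) x \<in> E}) \<partial>M) = real n * prob E"
proof -
  have "(\<integral>x. real (card {i\<in>{..<n}. (T ^^ i) x \<in> E}) \<partial>M) = (\<Sum>i<n. (\<integral>x. indicator E ((T ^^ i) x) \<partial>M))"
    unfolding card_visits_eq_sum
    by (intro Bochner_Integration.integral_sum integrable_const_bound[where B=1]) (auto simp: indicator_def)
  also have "\<dots> = (\<Sum>i<n. (\<integral>x. indicator E x \<partial>M))"
    by (intro sum.cong refl integral_funpow_T) auto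
  finally show ?thesis by (simp add: Int_absorb1 sets.sets_into_space)
qed

text \<open>The times at which an orbit enters \<open>H R\<close>, where windows have length at most
  \<open>R\<close>, are marked. Then \<open>card_hits_covering\<close> compares visits to
  \<open>H R\<close> before time \<open>L\<close> with visits to \<open>E\<close> before time
  \<open>L + R\<close>. Integrating and letting first \<open>L\<close>, then \<open>R\<close> tend
  to infinity gives the bound.\<close>

lemma maximal_inequality:
  fixes c :: real
  assumes [measurable]: "E \<in> sets M" and c: "0 < c"
  shows "prob {x\<in>space M. \<exists>n\<ge>1. c * real n \<le> real (card {i\<in>{..<n}. (T ^^ i) x \<in> E})} \<le> prob E / c"
proof -
  define H where "H R = {x\<in>space M. \<exists>n\<in>{1..R}. c * real n \<le> real (card {i\<in>{..<n}. (T ^^ i) x \<in> E})}" for R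
  have H [measurable]: "H R \<in> sets M" for R
    unfolding H_def by measurable
  have pointwise: "c * real (card {i\<in>{..<L}. (T ^^ i) x \<in> H R}) \<le> real (card {i\<in>{..<L+R}. (T ^^ i) x \<in> E})" for x L R
  proof -
    have "c * real (card {i\<in>{0..<L}. (T ^^ i) x \<in> H R}) \<le> real (card {i\<in>{0..<L+R}. (T ^^ i) x \<in> E})"
    proof (rule card_hits_covering)
      fix i assume "(T ^^ i) x \<in> H R"
      then obtain n where n: "n \<in> {1..R}"
        and *: "c * real n \<le> real (card {j\<in>{..<n}. (T ^^ j) ((T ^^ i) x) \<in> E})"
        by (auto simp: H_def)
      have "{j\<in>{i..<i+n}. (T ^^ j) x \<in> E} = (\<lambda>j. i + j) ` {j\<in>{..<n}. (T ^^ j) ((T ^^ i) x) \<in> E}"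
      proof (intro set_eqI iffI)
        fix j assume "j \<in> {j\<in>{i..<i+n}. (T ^^ j) x \<in> E}"
        then show "j \<in> (\<lambda>j. i + j) ` {j\<in>{..<n}. (T ^^ j) ((T ^^ i) x) \<in> E}"
          by (intro image_eqI[of _ _ "j - i"]) (auto simp: funpow_add[THEN fun_cong, unfolded comp_def, symmetric])
      next
        fix j assume "j \<in> (\<lambda>j. i + j) ` {j\<in>{..<n}. (T ^^ j) ((T ^^ i) x) \<in> E}"
        then show "j \<in> {j\<in>{i..<i+n}. (T ^^ j) x \<in> E}"
          by (auto simp: funpow_add[THEN fun_cong, unfolded comp_def, symmetric] add.commute)
      qed
      then have "card {j\<in>{i..<i+n}. (T ^^ j) x \<in> E} = card {j\<in>{..<n}. (T ^^ j) ((T ^^ i) x) \<in> E}"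
        by (simp add: card_image)
      then show "\<exists>n\<in>{1..R}. c * real n \<le> real (card {j\<in>{i..<i+n}. (T ^^ j) x \<in> E})"
        using n * by (intro bexI[OF _ n]) simp
    qed (use c in auto)
    then show ?thesis by (simp add: lessThan_atLeast0)
  qed
  have bound: "c * prob (H R) \<le> prob E" for R
  proof -
    \<comment> \<open>The term \<open>real R * prob E / real L\<close> is the price of windows that
      overrun time \<open>L\<close>; it vanishes as \<open>L\<close> grows.\<close>
    have "c * prob (H R) \<le> prob E + real R * prob E / real L" if L: "0 < L" for L
    proof -
      have "c * (real L * prob (H R)) = (\<integral>x. c * real (card {i\<in>{..<L}. (T ^^ i) x \<in> H R}) \<partial>M)"
        by (simp only: integral_card_visits[OF H] Bochner_Integration.integral_mult_right_zero)
      also have "\<dots> \<le> (\<integral>x. real (card {i\<in>{..<L+R}. (T ^^ i) x \<in> E}) \<partial>M)"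
        by (intro integral_mono pointwise integrable_card_visits integrable_mult_right H assms(1))
      also have "\<dots> = real (L + R) * prob E"
        by (rule integral_card_visits[OF assms(1)])
      finally have "c * (real L * prob (H R)) \<le> real (L + R) * prob E" .
      then show ?thesis using L by (simp add: field_simps)
    qed
    moreover have "(\<lambda>L. prob E + real R * prob E / real L) \<longlonglongrightarrow> prob E + 0"
      by (intro tendsto_intros lim_const_over_n)
    ultimately show ?thesis
      by (intro LIMSEQ_le_const[where X="\<lambda>L. prob E + real R * prob E / real L"]) (auto intro!: exI[of _ 1])
  qed
  \<comment> \<open>Continuity from below removes the bound \<open>R\<close> on the window
    length.\<close>
  have "incseq H" unfolding H_def by (rule monoI) fastforce
  then have "(\<lambda>R. prob (H R)) \<longlonglongrightarrow> prob (\<Union>R. H R)"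
    by (intro finite_Lim_measure_incseq) auto
  moreover have "(\<Union>R. H R) = {x\<in>space M. \<exists>n\<ge>1. c * real n \<le> real (card {i\<in>{..<n}. (T ^^ i) x \<in> E})}"
    unfolding H_def by fastforce
  ultimately show ?thesis
    using bound c by (intro LIMSEQ_le_const2[where X="\<lambda>R. prob (H R)"]) (auto simp: field_simps)
qed

end

section \<open>Partitions and relative frequencies\<close>

text \<open>What \<open>m\<close> deletions of 1 with relabelling leave of a block \<open>C\<close>,
  see \<open>block_of_funpow_delete_first\<close>. The condition \<open>1 \<le> k\<close> keeps the
  element \<open>m\<close> from becoming 0.\<close>

definition tail_set :: "nat \<Rightarrow> nat set \<Rightarrow> nat set" where
  "tail_set m C = {k. 1 \<le> k \<and> k + m \<in> C}"

definition rel_count :: "nat set \<Rightarrow> nat \<Rightarrow> real" where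
  "rel_count C n = real (card (C \<inter> {1..n})) / real n"

text \<open>The default 0 repeats the convention of \<open>freq\<close>, so that
  \<open>freq_eq\<close> holds whether or not the limit exists.\<close>

definition asymp_freq :: "nat set \<Rightarrow> real" where
  "asymp_freq C = (if convergent (rel_count C) then lim (rel_count C) else 0)"

text \<open>Given by a relation rather than by choosing a block, so that it makes sense for
  restricted partitions too and commutes with restriction
  (\<open>block_of_restrict_partition\<close>). It is empty if no block contains
  \<open>k\<close>.\<close>

definition block_of :: "nat set set \<Rightarrow> nat \<Rightarrow> nat set" where
  "block_of P k = {j. \<exists>B\<in>P. k \<in> B \<and> j \<in> B}"

lemma rel_freq_eq: "rel_freq P i = rel_count (block P i)"
  by (simp add: rel_freq_def rel_count_def fun_eq_iff)

lemma freq_eq: "freq P i = asymp_freq (block P i)"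
  by (simp add: freq_def asymp_freq_def rel_freq_eq)

lemma rel_count_range: "rel_count C n \<in> {0..1}"
proof -
  have "card (C \<inter> {1..n}) \<le> card {1..n}" by (intro card_mono) auto
  then show ?thesis by (auto simp: rel_count_def divide_le_eq_1)
qed

lemma rel_count_empty: "rel_count {} = (\<lambda>_. 0)"
  by (simp add: rel_count_def fun_eq_iff)

lemma asymp_freq_empty [simp]: "asymp_freq {} = 0"
  by (simp add: asymp_freq_def rel_count_empty)

lemma convergent_asymp_freq: "convergent (rel_count C) \<Longrightarrow> rel_count C \<longlonglongrightarrow> asymp_freq C"
  by (simp add: asymp_freq_def convergent_LIMSEQ_iff)

lemma asymp_freq_range: "asymp_freq C \<in> {0..1}"
proof (cases "convergent (rel_count C)")
  case True
  have "rel_count C n \<in> {0..1}" for n by (rule rel_count_range)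
  then show ?thesis
    using closed_sequentially[OF closed_atLeastAtMost _ convergent_asymp_freq[OF True]] by blast
qed (simp add: asymp_freq_def)

lemma tail_set_0: "0 \<notin> C \<Longrightarrow> tail_set 0 C = C"
proof -
  assume "0 \<notin> C"
  then have "1 \<le> k" if "k \<in> C" for k using that by (cases k) auto
  then show ?thesis by (auto simp: tail_set_def)
qed

lemma tail_set_tail_set: "tail_set m (tail_set l C) = tail_set (m + l) C"
  by (auto simp: tail_set_def ac_simps)

lemma card_tail_set: "card (tail_set m C \<inter> {1..n}) = card (C \<inter> {m+1..m+n})"
proof -
  have "C \<inter> {m+1..m+n} = (\<lambda>k. k + m) ` (tail_set m C \<inter> {1..n})"
  proof (intro set_eqI iffI)
    fix x assume "x \<in> C \<inter> {m+1..m+n}"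
    then show "x \<in> (\<lambda>k. k + m) ` (tail_set m C \<inter> {1..n})"
      by (intro image_eqI[of _ _ "x - m"]) (auto simp: tail_set_def)
  qed (auto simp: tail_set_def)
  then show ?thesis by (simp add: card_image)
qed

text \<open>Each of the intervals \<open>{1..n}\<close> and \<open>{m+1..m+n}\<close> has at most
  \<open>m\<close> points outside the other, so the counts differ by at most
  \<open>m\<close>.\<close>

lemma rel_count_tail_set_diff: "(\<lambda>n. rel_count (tail_set m C) n - rel_count C n) \<longlonglongrightarrow> 0"
proof (rule Lim_null_comparison)
  show "(\<lambda>n. real m / real n) \<longlonglongrightarrow> 0" by (rule lim_const_over_n)
  have "norm (rel_count (tail_set m C) n - rel_count C n) \<le> real m / real n" for n
  proof -
    have "card (C \<inter> {m+1..m+n}) \<le> card (C \<inter> {1..n} \<union> {n+1..n+m})" by (intro card_mono) auto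
    also have "\<dots> \<le> card (C \<inter> {1..n}) + m" using card_Un_le[of "C \<inter> {1..n}" "{n+1..n+m}"] by simp
    finally have 1: "card (C \<inter> {m+1..m+n}) \<le> card (C \<inter> {1..n}) + m" .
    have "card (C \<inter> {1..n}) \<le> card (C \<inter> {m+1..m+n} \<union> {1..m})" by (intro card_mono) auto
    also have "\<dots> \<le> card (C \<inter> {m+1..m+n}) + m" using card_Un_le[of "C \<inter> {m+1..m+n}" "{1..m}"] by simp
    finally have 2: "card (C \<inter> {1..n}) \<le> card (C \<inter> {m+1..m+n}) + m" .
    have "\<bar>real (card (C \<inter> {m+1..m+n})) - real (card (C \<inter> {1..n}))\<bar> \<le> real m"
      using 1 2 by linarith
    then show ?thesis
      unfolding rel_count_def card_tail_set
      by (auto simp: diff_divide_distrib[symmetric] abs_divide divide_right_mono)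
  qed
  then show "\<forall>\<^sub>F n in sequentially. norm (rel_count (tail_set m C) n - rel_count C n) \<le> real m / real n"
    by simp
qed

lemma rel_count_tail_set_iff: "rel_count (tail_set m C) \<longlonglongrightarrow> l \<longleftrightarrow> rel_count C \<longlonglongrightarrow> l"
proof
  assume "rel_count C \<longlonglongrightarrow> l"
  from tendsto_add[OF rel_count_tail_set_diff[of m C] this] show "rel_count (tail_set m C) \<longlonglongrightarrow> l" by simp
next
  assume "rel_count (tail_set m C) \<longlonglongrightarrow> l"
  from tendsto_diff[OF this rel_count_tail_set_diff[of m C]] show "rel_count C \<longlonglongrightarrow> l" by simp
qed

lemma convergent_tail_set: "convergent (rel_count (tail_set m C)) \<longleftrightarrow> convergent (rel_count C)"
  by (simp add: convergent_def rel_count_tail_set_iff)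

lemma asymp_freq_tail_set: "asymp_freq (tail_set m C) = asymp_freq C"
  by (simp add: asymp_freq_def convergent_tail_set lim_def rel_count_tail_set_iff)

section \<open>Blocks and their numbering by least elements\<close>

lemma partitions_pos: "P \<in> partitions \<Longrightarrow> B \<in> P \<Longrightarrow> 0 \<notin> B"
proof
  assume "P \<in> partitions" "B \<in> P" "0 \<in> B"
  then have "0 \<in> {1::nat..}" unfolding partitions_def by (metis UnionI mem_Collect_eq partition_onD1)
  then show False by simp
qed

lemma partitions_nonempty: "P \<in> partitions \<Longrightarrow> B \<in> P \<Longrightarrow> B \<noteq> {}"
  by (auto simp: partitions_def partition_on_def)

lemma block_of_eq:
  assumes "P \<in> partitions" "B \<in> P" "k \<in> B"
  shows "block_of P k = B"
  using assms by (auto simp: block_of_def partitions_def partition_on_def disjoint_def)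

lemma block_of_mem:
  assumes "P \<in> partitions" "1 \<le> k"
  shows "block_of P k \<in> P" "k \<in> block_of P k"
proof -
  obtain B where "B \<in> P" "k \<in> B"
    using assms by (auto simp: partitions_def partition_on_def)
  then show "block_of P k \<in> P" "k \<in> block_of P k" using block_of_eq assms by auto
qed

lemma Inf_mem_block: "P \<in> partitions \<Longrightarrow> B \<in> P \<Longrightarrow> Inf B \<in> B"
  by (simp add: Inf_nat_def1 partitions_nonempty)

lemma Inf_inj_on: "P \<in> partitions \<Longrightarrow> inj_on Inf P"
  by (rule inj_onI) (metis Inf_mem_block block_of_eq)

text \<open>The number under which \<open>block\<close> lists \<open>B\<close>. Injectivity
  (\<open>block_rank_inj_on\<close>) shows that the union in \<open>block\<close> has at most one
  member.\<close>

definition block_rank :: "nat set set \<Rightarrow> nat set \<Rightarrow> nat" where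
  "block_rank P B = card {C \<in> P. Inf C \<le> Inf B}"

text \<open>Blocks are determined by their least elements, and only the numbers up to
  \<open>n\<close> are available.\<close>

lemma finite_smaller_blocks: "P \<in> partitions \<Longrightarrow> finite {C \<in> P. Inf C \<le> (n::nat)}"
proof (rule finite_imageD)
  show "finite (Inf ` {C \<in> P. Inf C \<le> n})" by (rule finite_subset[of _ "{..n}"]) auto
  assume "P \<in> partitions"
  then show "inj_on Inf {C \<in> P. Inf C \<le> n}" by (rule inj_on_subset[OF Inf_inj_on]) auto
qed

lemma block_rank_pos: "P \<in> partitions \<Longrightarrow> B \<in> P \<Longrightarrow> 1 \<le> block_rank P B"
  unfolding block_rank_def using finite_smaller_blocks[of P "Inf B"]
  by (auto simp: Suc_le_eq card_gt_0_iff)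

text \<open>The rank is strictly increasing in the least element: the later block counts itself in
  addition to all that the earlier one counts.\<close>

lemma block_rank_inj_on:
  assumes P: "P \<in> partitions"
  shows "inj_on (block_rank P) P"
proof (rule inj_onI)
  have less: "block_rank P B < block_rank P C" if "B \<in> P" "C \<in> P" "Inf B < Inf C" for B C
  proof -
    have "C \<in> {D \<in> P. Inf D \<le> Inf C}" "C \<notin> {D \<in> P. Inf D \<le> Inf B}" using that by auto
    moreover have "{D \<in> P. Inf D \<le> Inf B} \<subseteq> {D \<in> P. Inf D \<le> Inf C}" using that by auto
    ultimately show ?thesis
      unfolding block_rank_def by (intro psubset_card_mono finite_smaller_blocks P) blast
  qed
  fix B C assume "B \<in> P" "C \<in> P" "block_rank P B = block_rank P C"
  then have "Inf B = Inf C" using less[of B C] less[of C B] by (metis less_irrefl linorder_neqE_nat)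
  then show "B = C" using Inf_inj_on[OF P] \<open>B \<in> P\<close> \<open>C \<in> P\<close> by (auto dest: inj_onD)
qed

lemma block_eq_Union: "block P i = \<Union>{B \<in> P. block_rank P B = i}"
  by (simp add: block_def block_rank_def)

lemma block_block_rank: "P \<in> partitions \<Longrightarrow> B \<in> P \<Longrightarrow> block P (block_rank P B) = B"
  unfolding block_eq_Union
  by (rule trans[of _ "\<Union>{B}"], rule arg_cong[of _ _ Union]) (auto dest: inj_onD[OF block_rank_inj_on])

lemma block_eq_empty: "i \<notin> block_rank P ` P \<Longrightarrow> block P i = {}"
  by (auto simp: block_eq_Union)

lemma mem_block_iff:
  assumes "P \<in> partitions" "1 \<le> k"
  shows "k \<in> block P i \<longleftrightarrow> block_rank P (block_of P k) = i"
proof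
  assume "k \<in> block P i"
  then obtain B where "B \<in> P" "block_rank P B = i" "k \<in> B" by (auto simp: block_eq_Union)
  then show "block_rank P (block_of P k) = i" using block_of_eq[OF assms(1)] by simp
next
  assume "block_rank P (block_of P k) = i"
  then show "k \<in> block P i"
    using block_of_mem[OF assms] block_block_rank[OF assms(1)] by blast
qed

text \<open>Reduces claims about all numbered blocks, absent ones included, to the blocks of
  elements \<open>k \<ge> 1\<close>. The witness is the least element of the block.\<close>

lemma block_cases:
  assumes "P \<in> partitions"
  obtains "block P i = {}" | k where "1 \<le> k" "block P i = block_of P k"
proof (cases "i \<in> block_rank P ` P")
  case True
  then obtain B where B: "B \<in> P" "i = block_rank P B" by auto
  have "Inf B \<in> B" using B assms by (simp add: Inf_mem_block)
  moreover have "1 \<le> Inf B" using partitions_pos[OF assms B(1)] \<open>Inf B \<in> B\<close>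
    by (metis One_nat_def Suc_leI neq0_conv)
  ultimately show thesis
    using that(2)[of "Inf B"] B assms by (simp add: block_block_rank block_of_eq)
qed (use that(1) block_eq_empty in blast)

text \<open>Every least element is at least 1, so the block of 1 is the only block counted in its
  own rank.\<close>

lemma block_1:
  assumes P: "P \<in> partitions"
  shows "block P 1 = block_of P 1"
proof -
  have mem: "block_of P 1 \<in> P" "1 \<in> block_of P 1" using block_of_mem[OF P] by auto
  have "Inf (block_of P 1) \<le> 1" using mem(2) by (simp add: cInf_lower)
  moreover have "1 \<le> Inf C" if "C \<in> P" for C
    using partitions_pos[OF P that] Inf_mem_block[OF P that] by (metis One_nat_def Suc_leI neq0_conv)
  ultimately have "{C \<in> P. Inf C \<le> Inf (block_of P 1)} = {block_of P 1}"
  proof (intro set_eqI iffI)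
    fix C assume C: "C \<in> {C \<in> P. Inf C \<le> Inf (block_of P 1)}"
    then have "Inf C = Inf (block_of P 1)"
      using \<open>Inf (block_of P 1) \<le> 1\<close> \<open>\<And>C. C \<in> P \<Longrightarrow> 1 \<le> Inf C\<close>[of C] by simp
    then show "C \<in> {block_of P 1}" using inj_onD[OF Inf_inj_on[OF P] _ _ mem(1)] C by simp
  qed (use mem in simp)
  then have "block_rank P (block_of P 1) = 1" by (simp add: block_rank_def)
  then show ?thesis using block_block_rank[OF P mem(1)] by simp
qed

section \<open>Deletion of the element 1\<close>

lemma delete_first_eq:
  assumes "P \<in> partitions"
  shows "delete_first P = tail_set 1 ` P - {{}}"
proof -
  have *: "(\<lambda>i. i - 1) ` (B \<inter> ({1..} - {1})) = tail_set 1 B" for B :: "nat set"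
  proof (intro set_eqI iffI)
    fix x assume "x \<in> tail_set 1 B"
    then show "x \<in> (\<lambda>i. i - 1) ` (B \<inter> ({1..} - {1}))"
      by (intro image_eqI[of _ _ "x + 1"]) (auto simp: tail_set_def)
  qed (auto simp: tail_set_def)
  have "delete_first P = (`) (\<lambda>i. i - 1) ` (\<lambda>B. B \<inter> ({1..} - {1})) ` P - {{}}"
    unfolding delete_first_def restrict_partition_def by auto
  then show ?thesis by (simp only: image_image *)
qed

text \<open>A point of the shifted block determines the original block by disjointness. Blocks with
  empty shift have to be left out, since there may be several of them.\<close>

lemma tail_set_inj_on:
  assumes P: "P \<in> partitions"
  shows "inj_on (tail_set m) {B \<in> P. tail_set m B \<noteq> {}}"
proof (rule inj_onI)
  fix B C assume BC: "B \<in> {B \<in> P. tail_set m B \<noteq> {}}" "C \<in> {B \<in> P. tail_set m B \<noteq> {}}"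
    "tail_set m B = tail_set m C"
  then have "tail_set m B \<noteq> {}" "B \<in> P" "C \<in> P" by simp_all
  then obtain k where k: "k \<in> tail_set m B" by blast
  then have "k \<in> tail_set m C" unfolding BC(3) .
  with k have "k + m \<in> B" "k + m \<in> C" by (simp_all add: tail_set_def)
  from block_of_eq[OF P \<open>B \<in> P\<close> this(1)] block_of_eq[OF P \<open>C \<in> P\<close> this(2)]
  show "B = C" by (rule trans[OF sym])
qed

lemma delete_first_partitions:
  assumes P: "P \<in> partitions"
  shows "delete_first P \<in> partitions"
  unfolding partitions_def
proof (intro CollectI partition_onI)
  show "\<Union> (delete_first P) = {1..}"
  proof (intro set_eqI iffI)
    fix x :: nat assume "x \<in> {1..}"
    then have x: "x \<in> tail_set 1 (block_of P (x + 1))"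
      using block_of_mem(2)[OF P, of "x + 1"] by (simp add: tail_set_def)
    moreover have "block_of P (x + 1) \<in> P" by (rule block_of_mem(1)[OF P]) simp
    ultimately have "tail_set 1 (block_of P (x + 1)) \<in> delete_first P"
      unfolding delete_first_eq[OF P] by blast
    with x show "x \<in> \<Union> (delete_first P)" by blast
  next
    fix x assume "x \<in> \<Union> (delete_first P)"
    then obtain B where "x \<in> tail_set 1 B" unfolding delete_first_eq[OF P] by blast
    then show "x \<in> {1..}" by (simp add: tail_set_def)
  qed
next
  fix p q assume "p \<in> delete_first P" "q \<in> delete_first P" "p \<noteq> q"
  then obtain B C where BC: "B \<in> P" "C \<in> P" "p = tail_set 1 B" "q = tail_set 1 C"
    unfolding delete_first_eq[OF P] by (elim DiffE imageE) (rule that)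
  have "disjoint P" using P unfolding partitions_def by (simp add: partition_onD2)
  moreover have "B \<noteq> C" using \<open>p \<noteq> q\<close> BC by blast
  ultimately have "B \<inter> C = {}" using BC disjointD by metis
  then show "disjnt p q" unfolding BC disjnt_iff tail_set_def by (simp add: disjoint_iff)
qed (simp add: delete_first_eq[OF P])

lemma block_of_delete_first:
  assumes P: "P \<in> partitions" and k: "1 \<le> k"
  shows "block_of (delete_first P) k = tail_set 1 (block_of P (k + 1))"
proof (rule block_of_eq[OF delete_first_partitions[OF P]])
  have "1 \<le> k + 1" by simp
  note mem = block_of_mem[OF P this]
  show k_mem: "k \<in> tail_set 1 (block_of P (k + 1))"
    using mem(2) k by (simp add: tail_set_def)
  show "tail_set 1 (block_of P (k + 1)) \<in> delete_first P"
    unfolding delete_first_eq[OF P] using imageI[OF mem(1)] k_mem by blast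
qed

lemma funpow_delete_first_partitions: "P \<in> partitions \<Longrightarrow> (delete_first ^^ m) P \<in> partitions"
  by (induction m) (auto simp: delete_first_partitions)

text \<open>With \<open>k = 1\<close>, the block of an arbitrary element becomes, up to a shift, the
  block of 1 in an iterate. In this way stationarity carries statements about 1 over to all
  elements.\<close>

lemma block_of_funpow_delete_first:
  assumes P: "P \<in> partitions" and k: "1 \<le> k"
  shows "block_of ((delete_first ^^ m) P) k = tail_set m (block_of P (k + m))"
  using k
proof (induction m arbitrary: k)
  case 0
  then show ?case
    using partitions_pos[OF P block_of_mem(1)[OF P 0]] by (simp add: tail_set_0)
next
  case (Suc m)
  have "block_of ((delete_first ^^ Suc m) P) k = tail_set 1 (block_of ((delete_first ^^ m) P) (k + 1))"
    using block_of_delete_first[OF funpow_delete_first_partitions[OF P] Suc.prems] by simp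
  also have "block_of ((delete_first ^^ m) P) (k + 1) = tail_set m (block_of P (k + 1 + m))"
    by (rule Suc.IH) simp
  finally show ?case by (simp add: tail_set_tail_set)
qed

lemma mem_block_of_iff: "j \<in> block_of P k \<longleftrightarrow> (\<exists>B\<in>P. k \<in> B \<and> j \<in> B)"
  by (simp add: block_of_def)

lemma mem_restrict_partition_iff:
  "D \<in> restrict_partition A P \<longleftrightarrow> (\<exists>B\<in>P. D = B \<inter> A) \<and> D \<noteq> {}"
  by (simp add: restrict_partition_def image_iff)

lemma block_of_restrict_partition:
  assumes i: "i \<in> A"
  shows "block_of (restrict_partition A P) i = block_of P i \<inter> A"
proof (intro set_eqI iffI)
  fix j assume "j \<in> block_of (restrict_partition A P) i"
  then obtain D where D: "D \<in> restrict_partition A P" "i \<in> D" "j \<in> D"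
    unfolding mem_block_of_iff by metis
  then obtain B where B: "B \<in> P" "D = B \<inter> A"
    unfolding mem_restrict_partition_iff by metis
  then have "i \<in> B" "j \<in> B" "j \<in> A" using D by simp_all
  then show "j \<in> block_of P i \<inter> A" using B(1) by (simp add: mem_block_of_iff) metis
next
  fix j assume "j \<in> block_of P i \<inter> A"
  then obtain B where B: "B \<in> P" "i \<in> B" "j \<in> B" and j: "j \<in> A"
    unfolding Int_iff mem_block_of_iff by metis
  have "B \<inter> A \<in> restrict_partition A P"
    unfolding mem_restrict_partition_iff using B i by (metis Int_iff empty_iff)
  moreover have "i \<in> B \<inter> A" "j \<in> B \<inter> A" using B i j by simp_all
  ultimately show "j \<in> block_of (restrict_partition A P) i"
    unfolding mem_block_of_iff by metis
qed

text \<open>For finite \<open>A\<close> this describes a restriction by the blocks of finitely many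
  elements; the restrictions of \<open>delete_first P\<close> are computed from it.\<close>

lemma restrict_partition_eq:
  assumes P: "P \<in> partitions" and A: "A \<subseteq> {1..}"
  shows "restrict_partition A P = (\<lambda>i. block_of P i \<inter> A) ` A"
proof (intro set_eqI iffI)
  fix D assume "D \<in> restrict_partition A P"
  then obtain B where B: "B \<in> P" "D = B \<inter> A" "D \<noteq> {}"
    unfolding mem_restrict_partition_iff by metis
  then obtain i where i: "i \<in> B" "i \<in> A" by auto
  have "D = block_of P i \<inter> A" by (simp add: block_of_eq[OF P B(1) i(1)] B(2))
  then show "D \<in> (\<lambda>i. block_of P i \<inter> A) ` A" using i(2) by (rule image_eqI)
next
  fix D assume "D \<in> (\<lambda>i. block_of P i \<inter> A) ` A"
  then obtain i where i: "i \<in> A" "D = block_of P i \<inter> A" by auto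
  then have "1 \<le> i" using A by auto
  note mem = block_of_mem[OF P this]
  have "D \<noteq> {}" using i mem(2) by auto
  then show "D \<in> restrict_partition A P"
    unfolding mem_restrict_partition_iff using i(2) mem(1) by metis
qed

section \<open>Measurability of blocks and of deletion\<close>

lemma space_partition_space [simp]: "space partition_space = partitions"
  unfolding partition_space_def by (rule space_measure_of) auto

text \<open>The generators are preimages of arbitrary sets \<open>X\<close> of restrictions, so
  every function of a single restriction is measurable, even for the discrete sigma-algebra on its
  values.\<close>

lemma measurable_of_restriction:
  assumes n: "1 \<le> n" and f: "\<And>P. P \<in> partitions \<Longrightarrow> f P = h (restrict_partition {1..n} P)"
  shows "f \<in> partition_space \<rightarrow>\<^sub>M count_space UNIV"
proof (rule measurableI)
  fix A
  have "f -` A \<inter> space partition_space = restrict_partition {1..n} -` (h -` A) \<inter> partitions"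
  proof (intro set_eqI)
    fix P
    show "P \<in> f -` A \<inter> space partition_space \<longleftrightarrow> P \<in> restrict_partition {1..n} -` (h -` A) \<inter> partitions"
      using f[of P] by auto
  qed
  also have "\<dots> \<in> sets partition_space"
    unfolding partition_space_def
  proof (rule in_measure_of)
    show "restrict_partition {1..n} -` (h -` A) \<inter> partitions
        \<in> {restrict_partition {1..n} -` X \<inter> partitions |n X. n \<ge> 1}"
      by (intro CollectI exI[of _ n] exI[of _ "h -` A"] conjI refl n)
  qed auto
  finally show "f -` A \<inter> space partition_space \<in> sets partition_space" .
qed simp

lemma measurable_mem_block_of [measurable]:
  "Measurable.pred partition_space (\<lambda>P. j \<in> block_of P k)"
proof (cases "1 \<le> k \<and> 1 \<le> j")
  case True
  then have "block_of (restrict_partition {1..max j k} P) k = block_of P k \<inter> {1..max j k}" for P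
    by (intro block_of_restrict_partition) simp
  moreover have "j \<in> {1..max j k}" using True by simp
  ultimately have "j \<in> block_of P k \<longleftrightarrow> j \<in> block_of (restrict_partition {1..max j k} P) k" for P
    by blast
  moreover have "1 \<le> max j k" using True by (auto simp: max_def)
  ultimately show ?thesis
    using measurable_of_restriction[of "max j k" "\<lambda>P. j \<in> block_of P k" "\<lambda>R. j \<in> block_of R k"]
    by metis
next
  \<comment> \<open>If \<open>j\<close> or \<open>k\<close> is 0, the event is empty, because 0
    belongs to no block.\<close>
  case False
  have "j \<in> block_of P k \<longleftrightarrow> False" if "P \<in> space partition_space" for P
  proof
    assume "j \<in> block_of P k"
    then obtain B where "B \<in> P" "k \<in> B" "j \<in> B" by (auto simp: block_of_def)
    moreover have "k = 0 \<or> j = 0" using False by auto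
    ultimately show False using partitions_pos[of P B] that by auto
  qed simp
  then have "Measurable.pred partition_space (\<lambda>P. j \<in> block_of P k) \<longleftrightarrow> Measurable.pred partition_space (\<lambda>_. False)"
    by (rule measurable_cong)
  then show ?thesis by (rule iffD2) (rule measurable_const, simp)
qed

text \<open>The restriction of \<open>delete_first P\<close> to \<open>{1..n}\<close> depends only
  on that of \<open>P\<close> to \<open>{1..n+1}\<close>, since deletion lowers every label by
  one.\<close>

lemma measurable_delete_first [measurable]: "delete_first \<in> partition_space \<rightarrow>\<^sub>M partition_space"
proof -
  have "delete_first \<in> partition_space \<rightarrow>\<^sub>M
    sigma partitions {restrict_partition {1..n} -` X \<inter> partitions |n X. n \<ge> 1}"
  proof (rule measurable_measure_of)
    fix Y assume "Y \<in> {restrict_partition {1..n} -` X \<inter> partitions |n X. n \<ge> 1}"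
    then obtain n X where n: "1 \<le> n" and Y: "Y = restrict_partition {1..n} -` X \<inter> partitions" by auto
    have meas: "(\<lambda>P. restrict_partition {1..n} (delete_first P)) \<in> partition_space \<rightarrow>\<^sub>M count_space UNIV"
    proof (rule measurable_of_restriction[where n="n+1" and
          h="\<lambda>R. (\<lambda>i. tail_set 1 (block_of R (i + 1)) \<inter> {1..n}) ` {1..n}"])
      fix P assume P: "P \<in> partitions"
      have "{1..n} \<subseteq> {1..}" by auto
      then have "restrict_partition {1..n} (delete_first P) = (\<lambda>i. block_of (delete_first P) i \<inter> {1..n}) ` {1..n}"
        by (rule restrict_partition_eq[OF delete_first_partitions[OF P]])
      also have "\<dots> = (\<lambda>i. tail_set 1 (block_of (restrict_partition {1..n+1} P) (i + 1)) \<inter> {1..n}) ` {1..n}"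
      proof (rule image_cong[OF refl])
        fix i assume i: "i \<in> {1..n}"
        then have "block_of (restrict_partition {1..n+1} P) (i + 1) = block_of P (i + 1) \<inter> {1..n+1}"
          by (intro block_of_restrict_partition) simp
        moreover have "block_of (delete_first P) i = tail_set 1 (block_of P (i + 1))"
          using i by (intro block_of_delete_first[OF P]) simp
        ultimately show "block_of (delete_first P) i \<inter> {1..n} =
            tail_set 1 (block_of (restrict_partition {1..n+1} P) (i + 1)) \<inter> {1..n}"
          by (auto simp: tail_set_def)
      qed
      finally show "restrict_partition {1..n} (delete_first P) =
          (\<lambda>i. tail_set 1 (block_of (restrict_partition {1..n+1} P) (i + 1)) \<inter> {1..n}) ` {1..n}" .
    qed simp
    have "delete_first -` Y \<inter> space partition_space =
      (\<lambda>P. restrict_partition {1..n} (delete_first P)) -` X \<inter> space partition_space"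
      unfolding Y by (auto simp: delete_first_partitions)
    also have "\<dots> \<in> sets partition_space" by (rule measurable_sets[OF meas]) simp
    finally show "delete_first -` Y \<inter> space partition_space \<in> sets partition_space" .
  next
    show "{restrict_partition {1..n} -` X \<inter> partitions |n X. n \<ge> 1} \<subseteq> Pow partitions" by auto
    show "delete_first \<in> space partition_space \<rightarrow> partitions"
      by (simp add: delete_first_partitions)
  qed
  then show ?thesis by (simp only: partition_space_def)
qed

text \<open>The rank of the block of \<open>k\<close> can be read off from the restriction to
  \<open>{1..k}\<close>: the blocks that it counts have least elements at most
  \<open>k\<close>.\<close>

lemma measurable_mem_block [measurable]:
  assumes k: "1 \<le> k"
  shows "Measurable.pred partition_space (\<lambda>P. k \<in> block P i)"
proof (rule measurable_of_restriction[OF k])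
  fix P assume P: "P \<in> partitions"
  \<comment> \<open>\<open>S P\<close> collects the least elements counted by the rank:
    \<open>l\<close> is the least element of its own block, and the block of \<open>k\<close> has no
    element below \<open>l\<close>.\<close>
  define S where "S R = {l \<in> {1..k}. \<forall>j\<in>{1..<l}. j \<notin> block_of R l \<and> j \<notin> block_of R k}" for R
  have "bij_betw Inf {C \<in> P. Inf C \<le> Inf (block_of P k)} (S P)"
    unfolding bij_betw_def
  proof (intro conjI set_eqI iffI)
    show "inj_on Inf {C \<in> P. Inf C \<le> Inf (block_of P k)}"
      by (rule inj_on_subset[OF Inf_inj_on[OF P]]) auto
  next
    fix l assume "l \<in> Inf ` {C \<in> P. Inf C \<le> Inf (block_of P k)}"
    then obtain C where C: "C \<in> P" "Inf C \<le> Inf (block_of P k)" "l = Inf C" by auto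
    have "Inf (block_of P k) \<le> k" using block_of_mem[OF P k] by (simp add: cInf_lower)
    moreover have "l \<in> C" using C Inf_mem_block[OF P] by simp
    moreover from this have "block_of P l = C" by (rule block_of_eq[OF P C(1)])
    moreover have "1 \<le> l" using partitions_pos[OF P C(1)] \<open>l \<in> C\<close> by (cases l) auto
    moreover have "l \<le> j" if "j \<in> C" for j unfolding C(3) by (rule cInf_lower[OF that]) simp
    moreover have "l \<le> j" if "j \<in> block_of P k" for j
      using C(2) cInf_lower[OF that] unfolding C(3) by simp
    ultimately show "l \<in> S P" using C(2,3) by (force simp: S_def)
  next
    fix l assume l: "l \<in> S P"
    then have l1: "1 \<le> l" by (simp add: S_def)
    have "l \<le> j" if "j \<in> block_of P l \<or> j \<in> block_of P k" for j
    proof (rule ccontr)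
      assume "\<not> l \<le> j"
      moreover have "j \<noteq> 0"
        using that partitions_pos[OF P block_of_mem(1)[OF P l1]] partitions_pos[OF P block_of_mem(1)[OF P k]] by metis
      ultimately show False using l that by (auto simp: S_def)
    qed
    note min = this
    have "Inf (block_of P l) = l"
      using min block_of_mem(2)[OF P l1] by (intro cInf_eq_minimum) auto
    moreover have "l \<le> Inf (block_of P k)"
      using min Inf_mem_block[OF P block_of_mem(1)[OF P k]] by auto
    ultimately show "l \<in> Inf ` {C \<in> P. Inf C \<le> Inf (block_of P k)}"
      using block_of_mem(1)[OF P l1] by (intro image_eqI[of _ _ "block_of P l"]) auto
  qed
  then have "block_rank P (block_of P k) = card (S P)"
    unfolding block_rank_def by (rule bij_betw_same_card)
  also have "S P = S (restrict_partition {1..k} P)"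
    using k by (auto simp: S_def block_of_restrict_partition)
  finally show "k \<in> block P i \<longleftrightarrow>
      card {l \<in> {1..k}. \<forall>j\<in>{1..<l}. j \<notin> block_of (restrict_partition {1..k} P) l \<and>
        j \<notin> block_of (restrict_partition {1..k} P) k} = i"
    by (simp add: mem_block_iff[OF P k] S_def)
qed

section \<open>Existence of the frequencies\<close>

lemma borel_measurable_rel_count:
  assumes [measurable]: "\<And>k. 1 \<le> k \<Longrightarrow> Measurable.pred N (\<lambda>x. k \<in> C x)"
  shows "(\<lambda>x. rel_count (C x) n) \<in> borel_measurable N"
proof -
  have "rel_count (C x) n = (\<Sum>k=1..n. if k \<in> C x then 1 else 0) / real n" for x
    by (simp add: rel_count_def sum.If_cases Int_commute)
  moreover have "(\<lambda>x. (\<Sum>k=1..n. if k \<in> C x then 1 else (0::real)) / real n) \<in> borel_measurable N"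
    by (intro borel_measurable_divide borel_measurable_sum measurable_If) auto
  ultimately show ?thesis by simp
qed

lemma borel_measurable_asymp_freq:
  assumes "\<And>k. 1 \<le> k \<Longrightarrow> Measurable.pred N (\<lambda>x. k \<in> C x)"
  shows "(\<lambda>x. asymp_freq (C x)) \<in> borel_measurable N"
proof -
  note [measurable] = borel_measurable_rel_count[OF assms]
  show ?thesis
    \<comment> \<open>The Cauchy condition can be expressed by countably many events, without naming
      the limit.\<close>
    unfolding asymp_freq_def Cauchy_convergent_iff[symmetric] by measurable
qed

lemma borel_measurable_freq [measurable]: "(\<lambda>P. freq P i) \<in> borel_measurable partition_space"
  unfolding freq_eq by (rule borel_measurable_asymp_freq) measurable

text \<open>\<open>M\<close> stands for the law of the random partition. Partitions are the sample
  points, and stationarity says that deletion of 1 preserves the law.\<close>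

locale stationary_partition_system = stationary_system M delete_first for M :: "nat set set measure" +
  assumes sets_M [measurable_cong]: "sets M = sets partition_space"
begin

lemma space_M [simp]: "space M = partitions"
  using sets_eq_imp_space_eq[OF sets_M] by simp

lemma borel_measurable_rel_count_block_of [measurable]:
  "(\<lambda>P. rel_count (block_of P k) n) \<in> borel_measurable M"
  by (rule borel_measurable_rel_count) measurable

text \<open>The element 1 is \<open>K\<close>-bad in the sense explained at the top.\<close>

definition delayed_light :: "real \<Rightarrow> nat \<Rightarrow> nat set set set" where
  "delayed_light a K = {P \<in> space M. (\<exists>n\<ge>1. rel_count (block_of P 1) n < a) \<and>
     (\<forall>n\<in>{1..K}. a \<le> rel_count (block_of P 1) n)}"

lemma delayed_light_sets [measurable]: "delayed_light a K \<in> sets M"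
  unfolding delayed_light_def by measurable

text \<open>The events decrease to the empty set: each member has a light window of some length
  \<open>n\<close> and is therefore missing from the event with \<open>K = n\<close>.\<close>

lemma prob_delayed_light: "(\<lambda>K. prob (delayed_light a K)) \<longlonglongrightarrow> 0"
proof -
  have "decseq (delayed_light a)"
    unfolding delayed_light_def by (rule antimonoI) auto
  moreover have "(\<Inter>K. delayed_light a K) = {}"
  proof (intro equals0I)
    fix P assume P: "P \<in> (\<Inter>K. delayed_light a K)"
    then have "P \<in> delayed_light a 0" by (rule INT_D) simp
    then obtain n where n: "1 \<le> n" "rel_count (block_of P 1) n < a" by (auto simp: delayed_light_def)
    have "P \<in> delayed_light a n" using P by (rule INT_D) simp
    then show False using n by (force simp: delayed_light_def)
  qed
  moreover have "range (delayed_light a) \<subseteq> sets M" using delayed_light_sets by blast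
  ultimately show ?thesis using finite_Lim_measure_decseq[of "delayed_light a"] by simp
qed

text \<open>The frequent values below \<open>p\<close> provide a light window from every point of
  the block, so a bad position \<open>i\<close> puts the \<open>i\<close>th iterate into
  \<open>delayed_light a K\<close>. A large \<open>n\<close> with relative frequency above
  \<open>q\<close> forces many bad positions by \<open>card_le_light_windows\<close>.\<close>

lemma oscillating_visits:
  assumes P: "P \<in> partitions"
    and pq: "0 \<le> p" "p < a" "a < q"
    and low: "\<exists>\<^sub>F n in sequentially. rel_count (block_of P 1) n < p"
    and high: "\<exists>\<^sub>F n in sequentially. q < rel_count (block_of P 1) n"
  shows "\<exists>n\<ge>1. (q - a) / 2 * real n \<le> real (card {i\<in>{..<n}. (delete_first ^^ i) P \<in> delayed_light a K})"
proof -
  define C where "C = block_of P 1"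
  define heavy where "heavy i \<longleftrightarrow> Suc i \<in> C \<and> (\<forall>n\<in>{1..K}. a * real n \<le> real (card (C \<inter> {i+1..i+n})))" for i
  have C: "C \<in> P" unfolding C_def by (rule block_of_mem[OF P]) simp
  have tail: "rel_count (block_of ((delete_first ^^ i) P) 1) n = real (card (C \<inter> {i+1..i+n})) / real n"
    if "Suc i \<in> C" for i n
    using block_of_funpow_delete_first[OF P, of 1 i] block_of_eq[OF P C that] card_tail_set[of i C n]
    by (simp add: rel_count_def)
  have sub: "(delete_first ^^ i) P \<in> delayed_light a K" if heavy: "heavy i" for i
  proof -
    have i: "Suc i \<in> C" using heavy by (simp add: heavy_def)
    have "\<forall>\<^sub>F m in sequentially. real i * a / (a - p) \<le> real m"
      using filterlim_real_sequentially by (simp add: filterlim_at_top)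
    then have "\<forall>\<^sub>F m in sequentially. real i * a / (a - p) \<le> real m \<and> i < m"
      using eventually_gt_at_top by (rule eventually_conj)
    \<comment> \<open>The bound on \<open>m\<close> is \<open>p * m \<le> a * (m - i)\<close> solved
      for \<open>m\<close>: a density below \<open>p\<close> on \<open>{1..m}\<close> yields a
      density below \<open>a\<close> on the part after \<open>i\<close>.\<close>
    then obtain m where m: "rel_count C m < p" "real i * a / (a - p) \<le> real m" "i < m"
      using frequently_ex[OF frequently_eventually_frequently[OF low]] unfolding C_def by blast
    have "real (card (C \<inter> {i+1..i+(m-i)})) \<le> real (card (C \<inter> {1..m}))"
      by (intro of_nat_mono card_mono) auto
    also have "\<dots> < p * real m" using m by (simp add: rel_count_def divide_less_eq)
    also have "p * real m \<le> a * real (m - i)"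
      using m pq by (simp add: of_nat_diff divide_le_eq algebra_simps)
    finally have "rel_count (block_of ((delete_first ^^ i) P) 1) (m - i) < a"
      unfolding tail[OF i] using m by (simp add: divide_less_eq)
    moreover have "1 \<le> m - i" using m by simp
    moreover have "a \<le> rel_count (block_of ((delete_first ^^ i) P) 1) n" if "n \<in> {1..K}" for n
      unfolding tail[OF i] using heavy that by (simp add: heavy_def le_divide_eq)
    ultimately show ?thesis
      unfolding delayed_light_def by (auto simp: funpow_delete_first_partitions[OF P])
  qed
  have "\<forall>\<^sub>F n in sequentially. real K / ((q - a) / 2) \<le> real n"
    using filterlim_real_sequentially by (simp add: filterlim_at_top)
  then have "\<forall>\<^sub>F n in sequentially. real K / ((q - a) / 2) \<le> real n \<and> 0 < n"
    using eventually_gt_at_top by (rule eventually_conj)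
  \<comment> \<open>The bound on \<open>n\<close> makes \<open>K\<close> at most half of the excess
    \<open>(q - a) * n\<close>; the other half has to come from the bad positions.\<close>
  then obtain n where n: "q < rel_count C n" "real K / ((q - a) / 2) \<le> real n" "0 < n"
    using frequently_ex[OF frequently_eventually_frequently[OF high]] unfolding C_def by blast
  have "q * real n < real (card (C \<inter> {0+1..0+n}))"
    using n by (simp add: rel_count_def less_divide_eq)
  also have "\<dots> \<le> a * real n + real K + real (card {i\<in>{0..<0+n}. heavy i})"
    unfolding heavy_def using pq by (intro card_le_light_windows) auto
  also have "card {i\<in>{0..<0+n}. heavy i} \<le> card {i\<in>{..<n}. (delete_first ^^ i) P \<in> delayed_light a K}"
    using sub by (intro card_mono) auto
  finally have "q * real n < a * real n + real K +
    real (card {i\<in>{..<n}. (delete_first ^^ i) P \<in> delayed_light a K})" by simp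
  moreover have "real K \<le> (q - a) / 2 * real n"
    using n pq by (simp add: divide_le_eq mult.commute)
  ultimately have "(q - a) / 2 * real n \<le> real (card {i\<in>{..<n}. (delete_first ^^ i) P \<in> delayed_light a K})"
    by (simp add: algebra_simps)
  then show ?thesis using n by (intro exI[of _ n]) simp
qed

text \<open>By \<open>oscillating_visits\<close>, an oscillating partition lies in
  \<open>H K\<close> for every \<open>K\<close>, while the maximal inequality bounds the probability
  of \<open>H K\<close> by a multiple of that of \<open>delayed_light a K\<close>, which tends to
  0.\<close>

lemma AE_not_oscillating:
  assumes pq: "0 \<le> p" "p < q"
  shows "AE P in M. \<not> ((\<exists>\<^sub>F n in sequentially. rel_count (block_of P 1) n < p) \<and>
    (\<exists>\<^sub>F n in sequentially. q < rel_count (block_of P 1) n))"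
proof -
  define a where "a = (p + q) / 2"
  define c where "c = (q - a) / 2"
  have a: "p < a" "a < q" and c: "0 < c" using pq by (auto simp: a_def c_def field_simps)
  define H where "H K = {P\<in>space M. \<exists>n\<ge>1. c * real n \<le>
    real (card {i\<in>{..<n}. (delete_first ^^ i) P \<in> delayed_light a K})}" for K
  have H [measurable]: "H K \<in> sets M" for K unfolding H_def by measurable
  have "prob (\<Inter>K. H K) \<le> prob (delayed_light a K) / c" for K
  proof -
    have "prob (\<Inter>K. H K) \<le> prob (H K)" by (intro finite_measure_mono H) auto
    also have "\<dots> \<le> prob (delayed_light a K) / c"
      unfolding H_def by (rule maximal_inequality[OF delayed_light_sets c])
    finally show ?thesis .
  qed
  moreover have "(\<lambda>K. prob (delayed_light a K) / c) \<longlonglongrightarrow> 0 / c"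
    using c by (intro tendsto_divide prob_delayed_light tendsto_const) simp
  ultimately have "prob (\<Inter>K. H K) \<le> 0"
    by (intro LIMSEQ_le_const[where X="\<lambda>K. prob (delayed_light a K) / c"]) auto
  then have "prob (\<Inter>K. H K) = 0" by (simp add: measure_le_0_iff)
  then have "AE P in M. P \<notin> (\<Inter>K. H K)"
    by (intro AE_not_in) (simp add: null_sets_def emeasure_eq_measure)
  then show ?thesis
  proof (rule AE_mp, intro AE_I2 impI notI)
    fix P assume P: "P \<in> space M" and "P \<notin> (\<Inter>K. H K)"
      and osc: "(\<exists>\<^sub>F n in sequentially. rel_count (block_of P 1) n < p) \<and>
        (\<exists>\<^sub>F n in sequentially. q < rel_count (block_of P 1) n)"
    have "P \<in> H K" for K
      unfolding H_def c_def using oscillating_visits[of P p a q K] P osc a pq by simp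
    then show False using \<open>P \<notin> (\<Inter>K. H K)\<close> by blast
  qed
qed

lemma AE_convergent_block_of_1: "AE P in M. convergent (rel_count (block_of P 1))"
proof -
  have "AE P in M. \<forall>p\<in>\<rat>. \<forall>q\<in>\<rat>. 0 \<le> p \<and> p < q \<longrightarrow>
    \<not> ((\<exists>\<^sub>F n in sequentially. rel_count (block_of P 1) n < p) \<and>
      (\<exists>\<^sub>F n in sequentially. q < rel_count (block_of P 1) n))"
    by (intro AE_ball_countable' countable_rat AE_impI AE_not_oscillating) simp_all
  then show ?thesis
  proof (rule AE_mp, intro AE_I2 impI)
    fix P assume no: "\<forall>p\<in>\<rat>. \<forall>q\<in>\<rat>. 0 \<le> p \<and> p < q \<longrightarrow>
      \<not> ((\<exists>\<^sub>F n in sequentially. rel_count (block_of P 1) n < p) \<and>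
        (\<exists>\<^sub>F n in sequentially. q < rel_count (block_of P 1) n))"
    show "convergent (rel_count (block_of P 1))"
    proof (rule ccontr)
      assume "\<not> convergent (rel_count (block_of P 1))"
      then show False
        by (rule not_convergent_oscillates[OF _ rel_count_range]) (use no in metis)
    qed
  qed
qed

text \<open>Almost sure convergence for the block of 1 holds in all iterates at once, and the block
  of \<open>k\<close> is, up to a shift, the block of 1 in iterate \<open>k - 1\<close>.\<close>

lemma AE_convergent_block_of: "AE P in M. \<forall>k\<ge>1::nat. convergent (rel_count (block_of P k))"
proof -
  have "AE P in M. \<forall>i. convergent (rel_count (block_of ((delete_first ^^ i) P) 1))"
    unfolding AE_all_countable using AE_funpow_T[OF AE_convergent_block_of_1] by blast
  then show ?thesis
  proof (rule AE_mp, intro AE_I2 impI allI)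
    fix P and k :: nat
    assume P: "P \<in> space M" and k: "1 \<le> k"
      and conv: "\<forall>i. convergent (rel_count (block_of ((delete_first ^^ i) P) 1))"
    have "block_of ((delete_first ^^ (k - 1)) P) 1 = tail_set (k - 1) (block_of P (1 + (k - 1)))"
      using P by (intro block_of_funpow_delete_first) auto
    also have "1 + (k - 1) = k" using k by simp
    finally have "convergent (rel_count (tail_set (k - 1) (block_of P k)))"
      using spec[OF conv, of "k - 1"] by simp
    then show "convergent (rel_count (block_of P k))" by (simp only: convergent_tail_set)
  qed
qed

lemma AE_convergent_block: "AE P in M. \<forall>i. convergent (rel_count (block P i))"
  using AE_convergent_block_of
proof (rule AE_mp, intro AE_I2 impI allI)
  fix P i assume P: "P \<in> space M" and conv: "\<forall>k\<ge>1::nat. convergent (rel_count (block_of P k))"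
  have "P \<in> partitions" using P by simp
  then show "convergent (rel_count (block P i))"
    by (rule block_cases[of P i]) (use conv in \<open>auto simp: rel_count_empty convergent_const\<close>)
qed

end

section \<open>The unordered frequency distribution\<close>

lemma block_eq_block_of:
  assumes "P \<in> partitions" "1 \<le> k" "k \<in> block P i"
  shows "block P i = block_of P k"
  using assms block_block_rank[OF assms(1) block_of_mem(1)[OF assms(1,2)]] by (simp add: mem_block_iff)

lemma disjoint_blocks:
  assumes "P \<in> partitions" "i \<noteq> j"
  shows "(block P i \<inter> {1..n}) \<inter> (block P j \<inter> {1..n}) = {}"
  using assms by (auto simp: mem_block_iff)

lemma sum_rel_count_block_le:
  assumes P: "P \<in> partitions" and I: "finite I"
  shows "(\<Sum>i\<in>I. rel_count (block P i) n) \<le> 1"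
proof -
  have "(\<Sum>i\<in>I. card (block P i \<inter> {1..n})) = card (\<Union>i\<in>I. block P i \<inter> {1..n})"
    using I disjoint_blocks[OF P] by (intro card_UN_disjoint[symmetric]) auto
  also have "\<dots> \<le> card {1..n}" by (intro card_mono) auto
  finally have "real (\<Sum>i\<in>I. card (block P i \<inter> {1..n})) \<le> real n"
    unfolding of_nat_le_iff by simp
  then show ?thesis
    by (cases "n = 0") (simp_all add: rel_count_def sum_divide_distrib[symmetric] divide_le_eq_1)
qed

lemma freq_range: "freq P i \<in> {0..1}"
  unfolding freq_eq by (rule asymp_freq_range)

lemma freq_nonneg [simp]: "0 \<le> freq P i"
  using freq_range[of P i] by simp

text \<open>For blocks with a limit the bound is inherited from the relative frequencies; the others
  count 0 by convention. Hence it holds for every partition, not just almost surely.\<close>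

lemma sum_freq_le:
  assumes P: "P \<in> partitions" and I: "finite I"
  shows "(\<Sum>i\<in>I. freq P i) \<le> 1"
proof -
  define J where "J = {i\<in>I. convergent (rel_count (block P i))}"
  have J: "finite J" "J \<subseteq> I" using I by (auto simp: J_def)
  have "(\<Sum>i\<in>I. freq P i) = (\<Sum>i\<in>J. freq P i)"
    using I by (intro sum.mono_neutral_right) (auto simp: J_def freq_eq asymp_freq_def)
  also have "(\<lambda>n. \<Sum>i\<in>J. rel_count (block P i) n) \<longlonglongrightarrow> (\<Sum>i\<in>J. freq P i)"
    unfolding freq_eq by (intro tendsto_sum convergent_asymp_freq) (simp add: J_def)
  then have "(\<Sum>i\<in>J. freq P i) \<le> 1"
    by (rule LIMSEQ_le_const2) (use sum_rel_count_block_le[OF P J(1)] in blast)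
  finally show ?thesis .
qed

lemma summable_freq: "P \<in> partitions \<Longrightarrow> summable (\<lambda>i. freq P (Suc i))"
  and suminf_freq_le: "P \<in> partitions \<Longrightarrow> (\<Sum>i. freq P (Suc i)) \<le> 1"
proof -
  assume P: "P \<in> partitions"
  have le: "(\<Sum>i<n. freq P (Suc i)) \<le> 1" for n
    using sum_freq_le[OF P, of "Suc ` {..<n}"] by (simp add: sum.reindex)
  show s: "summable (\<lambda>i. freq P (Suc i))"
    by (rule summableI_nonneg_bounded[where x=1]) (simp_all add: le)
  show "(\<Sum>i. freq P (Suc i)) \<le> 1"
    by (rule suminf_le_const[OF s le])
qed

text \<open>Turns a sum over numbers into a sum over the set of blocks, which does not depend on
  their order. Numbers without a block have frequency 0, and \<open>h 0 = 0\<close> discards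
  them.\<close>

lemma suminf_freq_eq_blocks:
  fixes h :: "real \<Rightarrow> ennreal"
  assumes P: "P \<in> partitions" and h: "h 0 = 0"
  shows "(\<Sum>i. h (freq P (Suc i))) = (\<integral>\<^sup>+B. h (asymp_freq B) \<partial>count_space P)"
proof -
  have "(\<integral>\<^sup>+B. h (asymp_freq B) \<partial>count_space P) = (\<integral>\<^sup>+B. h (freq P (block_rank P B)) \<partial>count_space P)"
    by (intro nn_integral_cong) (simp add: freq_eq block_block_rank[OF P])
  also have "\<dots> = (\<integral>\<^sup>+i. h (freq P i) \<partial>count_space (block_rank P ` P))"
    using block_rank_inj_on[OF P] by (intro nn_integral_bij_count_space) (simp add: bij_betw_def)
  also have "\<dots> = (\<integral>\<^sup>+i. h (freq P i) \<partial>count_space {1..})"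
    using block_rank_pos[OF P] h by (intro nn_integral_count_space_eq) (auto simp: freq_eq block_eq_empty)
  also have "\<dots> = (\<integral>\<^sup>+i. h (freq P (Suc i)) \<partial>count_space UNIV)"
  proof (rule nn_integral_bij_count_space[symmetric])
    show "bij_betw Suc UNIV {1..}"
      by (rule bij_betwI[where g="\<lambda>i. i - 1"]) auto
  qed
  finally show ?thesis by (simp add: nn_integral_count_space_nat)
qed

text \<open>Deletion may renumber the blocks, but the only block it can remove is
  \<open>{1}\<close>, of frequency 0; all others keep their frequencies under the shift.\<close>

lemma suminf_freq_delete_first:
  fixes h :: "real \<Rightarrow> ennreal"
  assumes P: "P \<in> partitions" and h: "h 0 = 0"
  shows "(\<Sum>i. h (freq (delete_first P) (Suc i))) = (\<Sum>i. h (freq P (Suc i)))"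
proof -
  have im: "delete_first P = tail_set 1 ` {B \<in> P. tail_set 1 B \<noteq> {}}"
    unfolding delete_first_eq[OF P] by auto
  have "(\<Sum>i. h (freq (delete_first P) (Suc i))) = (\<integral>\<^sup>+B. h (asymp_freq B) \<partial>count_space (delete_first P))"
    by (rule suminf_freq_eq_blocks[where h=h, OF delete_first_partitions[OF P] h])
  also have "\<dots> = (\<integral>\<^sup>+B. h (asymp_freq (tail_set 1 B)) \<partial>count_space {B \<in> P. tail_set 1 B \<noteq> {}})"
    unfolding im using tail_set_inj_on[OF P, of 1]
    by (intro nn_integral_bij_count_space[symmetric]) (simp add: bij_betw_def)
  also have "\<dots> = (\<integral>\<^sup>+B. h (asymp_freq B) \<partial>count_space {B \<in> P. tail_set 1 B \<noteq> {}})"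
    by (simp only: asymp_freq_tail_set)
  also have "\<dots> = (\<integral>\<^sup>+B. h (asymp_freq B) \<partial>count_space P)"
  proof (rule nn_integral_count_space_eq)
    fix B assume "B \<in> P - {B \<in> P. tail_set 1 B \<noteq> {}}"
    then have "asymp_freq B = 0" using asymp_freq_tail_set[of 1 B] by simp
    then show "h (asymp_freq B) = 0" using h by simp
  qed auto
  also have "\<dots> = (\<Sum>i. h (freq P (Suc i)))"
    by (rule suminf_freq_eq_blocks[where h=h, OF P h, symmetric])
  finally show ?thesis .
qed

text \<open>The total frequency uses \<open>h = ennreal\<close>; the atoms use \<open>x\<close>
  times the unit mass at \<open>x\<close>, evaluated at \<open>A\<close>. Both vanish at
  \<open>x = 0\<close>.\<close>

lemma unordered_freq_dist_delete_first:
  assumes P: "P \<in> partitions"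
  shows "unordered_freq_dist (delete_first P) = unordered_freq_dist P"
proof -
  have "ennreal (\<Sum>i. freq (delete_first P) (Suc i)) = ennreal (\<Sum>i. freq P (Suc i))"
    using suminf_freq_delete_first[OF P, of ennreal]
    by (simp add: suminf_ennreal2 summable_freq P delete_first_partitions)
  then have "(\<Sum>i. freq (delete_first P) (Suc i)) = (\<Sum>i. freq P (Suc i))"
    by (simp add: suminf_nonneg summable_freq P delete_first_partitions)
  moreover have "(\<Sum>i. ennreal (freq (delete_first P) (Suc i)) *
        emeasure (return unit_interval (freq (delete_first P) (Suc i))) A) =
      (\<Sum>i. ennreal (freq P (Suc i)) * emeasure (return unit_interval (freq P (Suc i))) A)" for A
    by (rule suminf_freq_delete_first[OF P, of "\<lambda>x. ennreal x * emeasure (return unit_interval x) A"]) simp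
  ultimately show ?thesis unfolding unordered_freq_dist_def by simp
qed

text \<open>The set function passed to \<open>measure_of\<close> must be countably additive, since otherwise the
  result is the null measure; it is, being a push-forward of weights on the natural numbers.\<close>

lemma shows sets_unordered_freq_dist [simp]: "sets (unordered_freq_dist P) = sets unit_interval"
  and emeasure_unordered_freq_dist: "A \<in> sets unit_interval \<Longrightarrow>
    emeasure (unordered_freq_dist P) A =
      (\<Sum>i. ennreal (freq P (Suc i)) * indicator A (freq P (Suc i)))
        + ennreal (1 - (\<Sum>i. freq P (Suc i))) * indicator A 0"
proof -
  \<comment> \<open>Weights \<open>w\<close> and positions \<open>x\<close> of the atoms: index 0 is
    the remaining mass at 0, index \<open>i + 1\<close> the block numbered
    \<open>i + 1\<close>.\<close>
  define w where "w = case_nat (1 - (\<Sum>i. freq P (Suc i))) (\<lambda>i. freq P (Suc i))"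
  define x where "x = case_nat 0 (\<lambda>i. freq P (Suc i))"
  define D where "D = distr (density (count_space UNIV) (\<lambda>i. ennreal (w i))) unit_interval x"
  have x: "x \<in> density (count_space UNIV) (\<lambda>i. ennreal (w i)) \<rightarrow>\<^sub>M unit_interval"
  proof (rule measurableI)
    show "x i \<in> space unit_interval" for i
      using freq_range by (cases i) (auto simp: x_def space_restrict_space)
  qed simp
  have em: "emeasure D A = (\<Sum>i. ennreal (freq P (Suc i)) * indicator A (freq P (Suc i)))
      + ennreal (1 - (\<Sum>i. freq P (Suc i))) * indicator A 0"
    if A: "A \<in> sets unit_interval" for A
  proof -
    have "emeasure D A = (\<integral>\<^sup>+i. ennreal (w i) * indicator (x -` A) i \<partial>count_space UNIV)"
      using A by (simp add: D_def emeasure_distr[OF x] emeasure_density)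
    also have "\<dots> = (\<Sum>i. ennreal (w i) * indicator A (x i))"
      by (simp add: nn_integral_count_space_nat indicator_def)
    also have "\<dots> = (\<Sum>i. ennreal (w (i + 1)) * indicator A (x (i + 1))) +
        (\<Sum>i<1. ennreal (w i) * indicator A (x i))"
      by (rule suminf_offset) simp
    finally show ?thesis by (simp add: w_def x_def)
  qed
  have D: "space D = {0..1}" "sets D = sets unit_interval"
    by (simp_all add: D_def space_restrict_space)
  have "unordered_freq_dist P = measure_of (space D) (sets D) (emeasure D)"
    unfolding unordered_freq_dist_def D
  proof (rule measure_of_eq)
    show "sets unit_interval \<subseteq> Pow {0..1}"
      using sets.space_closed[of unit_interval] by (simp add: space_restrict_space)
    fix A assume "A \<in> sigma_sets {0..1} (sets unit_interval)"
    then have "A \<in> sets unit_interval"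
      using sets.sigma_sets_eq[of unit_interval] by (simp add: space_restrict_space)
    then show "(\<Sum>i. ennreal (freq P (Suc i)) * emeasure (return unit_interval (freq P (Suc i))) A)
      + ennreal (1 - (\<Sum>i. freq P (Suc i))) * emeasure (return unit_interval 0) A = emeasure D A"
      by (simp add: em)
  qed
  then have eq: "unordered_freq_dist P = D" by (simp only: measure_of_of_measure)
  show "sets (unordered_freq_dist P) = sets unit_interval" by (simp add: eq D)
  show "A \<in> sets unit_interval \<Longrightarrow> emeasure (unordered_freq_dist P) A =
      (\<Sum>i. ennreal (freq P (Suc i)) * indicator A (freq P (Suc i)))
        + ennreal (1 - (\<Sum>i. freq P (Suc i))) * indicator A 0"
    unfolding eq by (rule em)
qed

text \<open>By \<open>suminf_freq_le\<close> the mass at 0 is nonnegative, so \<open>ennreal\<close>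
  does not truncate it and the masses add up to 1.\<close>

lemma prob_space_unordered_freq_dist:
  assumes P: "P \<in> partitions"
  shows "prob_space (unordered_freq_dist P)"
proof (rule prob_spaceI)
  have sp: "space (unordered_freq_dist P) = {0..1}"
    using sets_eq_imp_space_eq[OF sets_unordered_freq_dist] by (simp add: space_restrict_space)
  have "{0..1} \<in> sets unit_interval" using sets.top[of unit_interval] by (simp add: space_restrict_space)
  then have "emeasure (unordered_freq_dist P) {0..1} =
      (\<Sum>i. ennreal (freq P (Suc i))) + ennreal (1 - (\<Sum>i. freq P (Suc i)))"
    using freq_range[of P] by (simp add: emeasure_unordered_freq_dist indicator_def)
  also have "\<dots> = ennreal ((\<Sum>i. freq P (Suc i)) + (1 - (\<Sum>i. freq P (Suc i))))"
    using suminf_freq_le[OF P] by (simp add: suminf_ennreal2 summable_freq[OF P] suminf_nonneg ennreal_plus[symmetric] del: ennreal_plus)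
  finally show "emeasure (unordered_freq_dist P) (space (unordered_freq_dist P)) = 1"
    unfolding sp by simp
qed

lemma measurable_unordered_freq_dist [measurable]:
  "unordered_freq_dist \<in> partition_space \<rightarrow>\<^sub>M prob_algebra unit_interval"
proof (rule measurable_prob_algebraI)
  show "prob_space (unordered_freq_dist P)" if "P \<in> space partition_space" for P
    using that by (simp add: prob_space_unordered_freq_dist)
  show "unordered_freq_dist \<in> partition_space \<rightarrow>\<^sub>M subprob_algebra unit_interval"
  proof (rule measurable_subprob_algebra)
    show "subprob_space (unordered_freq_dist P)" if "P \<in> space partition_space" for P
      using that by (simp add: prob_space_unordered_freq_dist prob_space_imp_subprob_space)
    fix A assume A: "A \<in> sets unit_interval"
    then have [measurable]: "A \<in> sets borel"
      by (simp add: sets_restrict_space_iff)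
    show "(\<lambda>P. emeasure (unordered_freq_dist P) A) \<in> borel_measurable partition_space"
      unfolding emeasure_unordered_freq_dist[OF A] by measurable
  qed simp
qed

lemma measurable_freq_unit_interval [measurable]: "(\<lambda>P. freq P i) \<in> partition_space \<rightarrow>\<^sub>M unit_interval"
  using freq_range by (intro measurable_restrict_space2 borel_measurable_freq) auto

text \<open>Frequencies of at least \<open>e\<close> with sum at most 1 number at most
  \<open>1 / e\<close>.\<close>

lemma finite_large_freq:
  assumes P: "P \<in> partitions" and e: "0 < e" "A \<subseteq> {e..1}"
  shows "finite {i. freq P (Suc i) \<in> A}"
proof -
  have "card I \<le> nat \<lfloor>1 / e\<rfloor>" if I: "I \<subseteq> {i. freq P (Suc i) \<in> A}" "finite I" for I
  proof -
    have "real (card I) * e = (\<Sum>i\<in>I. e)" by simp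
    also have "\<dots> \<le> (\<Sum>i\<in>I. freq P (Suc i))" using I e by (intro sum_mono) auto
    also have "\<dots> = (\<Sum>i\<in>Suc ` I. freq P i)" by (simp add: sum.reindex)
    also have "\<dots> \<le> 1" using I by (intro sum_freq_le[OF P]) simp
    finally have "real (card I) \<le> 1 / e" using e by (simp add: field_simps)
    then show ?thesis by (simp add: le_nat_floor)
  qed
  then show ?thesis
    using finite_if_finite_subsets_card_bdd[of "{i. freq P (Suc i) \<in> A}" "nat \<lfloor>1 / e\<rfloor>"] by blast
qed

text \<open>The atom at 0 lies outside \<open>A\<close>, and by \<open>finite_large_freq\<close> the
  series is a finite sum.\<close>

lemma measure_unordered_freq_dist_large:
  assumes P: "P \<in> partitions" and e: "0 < e" "A \<subseteq> {e..1}" and A: "A \<in> sets unit_interval"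
  shows "measure (unordered_freq_dist P) A = (\<Sum>i | freq P (Suc i) \<in> A. freq P (Suc i))"
proof -
  have "emeasure (unordered_freq_dist P) A = (\<Sum>i. ennreal (freq P (Suc i)) * indicator A (freq P (Suc i)))"
    using e by (auto simp: emeasure_unordered_freq_dist[OF A] indicator_def)
  also have "\<dots> = (\<Sum>i | freq P (Suc i) \<in> A. ennreal (freq P (Suc i)) * indicator A (freq P (Suc i)))"
    by (rule suminf_finite[OF finite_large_freq[OF P e]]) simp
  also have "\<dots> = ennreal (\<Sum>i | freq P (Suc i) \<in> A. freq P (Suc i))"
    by (simp add: sum_ennreal)
  finally show ?thesis by (simp add: measure_def sum_nonneg)
qed

text \<open>The elements are sorted by the block that contains them; the frequency is the same for
  all elements of a block.\<close>

lemma card_large_freq_eq: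
  assumes P: "P \<in> partitions" and e: "0 < e" "A \<subseteq> {e..1}"
  shows "card {k\<in>{1..n}. asymp_freq (block_of P k) \<in> A} =
    (\<Sum>i | freq P (Suc i) \<in> A. card (block P (Suc i) \<inter> {1..n}))"
proof -
  have "{k\<in>{1..n}. asymp_freq (block_of P k) \<in> A} = (\<Union>i\<in>{i. freq P (Suc i) \<in> A}. block P (Suc i) \<inter> {1..n})"
  proof (intro set_eqI iffI)
    fix k assume k: "k \<in> {k\<in>{1..n}. asymp_freq (block_of P k) \<in> A}"
    define i where "i = block_rank P (block_of P k) - 1"
    have "1 \<le> k" using k by simp
    have "block_rank P (block_of P k) = Suc i"
      using block_rank_pos[OF P block_of_mem(1)[OF P \<open>1 \<le> k\<close>]] by (simp add: i_def)
    then have mem: "k \<in> block P (Suc i)" using mem_block_iff[OF P \<open>1 \<le> k\<close>] by simp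
    then have "freq P (Suc i) \<in> A" using k block_eq_block_of[OF P \<open>1 \<le> k\<close> mem] by (simp add: freq_eq)
    then show "k \<in> (\<Union>i\<in>{i. freq P (Suc i) \<in> A}. block P (Suc i) \<inter> {1..n})"
      using mem k by (intro UN_I[of i]) simp_all
  next
    fix k assume "k \<in> (\<Union>i\<in>{i. freq P (Suc i) \<in> A}. block P (Suc i) \<inter> {1..n})"
    then obtain i where i: "freq P (Suc i) \<in> A" "k \<in> block P (Suc i)" "1 \<le> k" "k \<le> n" by auto
    then show "k \<in> {k\<in>{1..n}. asymp_freq (block_of P k) \<in> A}"
      using block_eq_block_of[OF P i(3,2)] by (simp add: freq_eq)
  qed
  then show ?thesis
    using disjoint_blocks[OF P] finite_large_freq[OF P e]
    by (simp only:) (intro card_UN_disjoint; simp)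
qed

text \<open>As \<open>A\<close> stays away from 0, the proportion is a sum of finitely many relative
  frequencies, and the limit may be taken term by term.\<close>

lemma tendsto_card_large_freq:
  assumes P: "P \<in> partitions" and e: "0 < e" "A \<subseteq> {e..1}" and A: "A \<in> sets unit_interval"
    and conv: "\<And>i. convergent (rel_count (block P i))"
  shows "(\<lambda>n. real (card {k\<in>{1..n}. asymp_freq (block_of P k) \<in> A}) / real n)
    \<longlonglongrightarrow> measure (unordered_freq_dist P) A"
proof -
  have "real (card {k\<in>{1..n}. asymp_freq (block_of P k) \<in> A}) / real n =
      (\<Sum>i | freq P (Suc i) \<in> A. rel_count (block P (Suc i)) n)" for n
    unfolding card_large_freq_eq[OF P e] by (simp add: rel_count_def sum_divide_distrib)
  then show ?thesis
    unfolding measure_unordered_freq_dist_large[OF P e A]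
    using convergent_asymp_freq[OF conv] by (auto simp: freq_eq intro!: tendsto_sum)
qed

section \<open>Conditional law of the first frequency\<close>

context stationary_partition_system
begin

lemma measurable_asymp_freq_block_of [measurable]:
  "(\<lambda>P. asymp_freq (block_of P k)) \<in> borel_measurable M"
  by (rule borel_measurable_asymp_freq) measurable

lemma measurable_unordered_freq_dist_M:
  assumes "A \<in> sets unit_interval"
  shows "(\<lambda>P. measure (unordered_freq_dist P) A) \<in> borel_measurable M"
  using measurable_compose[OF measurable_unordered_freq_dist measurable_measure_prob_algebra[OF assms]]
  by (simp add: measurable_cong_sets[OF sets_M refl])

lemma prob_space_freq_dist: "P \<in> space M \<Longrightarrow> prob_space (unordered_freq_dist P)"
  by (simp add: prob_space_unordered_freq_dist)

text \<open>Test functions for the conditional expectation. Invariance lets the weight be carried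
  along when 1 is replaced by another element; indicators of events generated by
  \<open>unordered_freq_dist\<close> are of this kind.\<close>

definition invariant_weight :: "(nat set set \<Rightarrow> real) \<Rightarrow> bool" where
  "invariant_weight g \<longleftrightarrow> g \<in> borel_measurable M \<and> range g \<subseteq> {0..1} \<and>
     (\<forall>P\<in>partitions. g (delete_first P) = g P)"

lemma invariant_weight_funpow:
  "invariant_weight g \<Longrightarrow> P \<in> partitions \<Longrightarrow> g ((delete_first ^^ n) P) = g P"
  by (induction n) (auto simp: invariant_weight_def funpow_delete_first_partitions)

text \<open>By stationarity, the block of each \<open>k \<le> n\<close> gives the same integral as
  the block of 1, hence so does their average. The average converges almost surely by
  \<open>tendsto_card_large_freq\<close>, and dominated convergence concludes.\<close>

lemma integral_freq_1_large:
  assumes g: "invariant_weight g" and e: "0 < e" "A \<subseteq> {e..1}" and A: "A \<in> sets unit_interval"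
  shows "(\<integral>P. g P * indicator A (freq P 1) \<partial>M) = (\<integral>P. g P * measure (unordered_freq_dist P) A \<partial>M)"
proof -
  have [measurable]: "A \<in> sets borel" using A by (simp add: sets_restrict_space_iff)
  have g_meas [measurable]: "g \<in> borel_measurable M" and g01: "0 \<le> g P" "g P \<le> 1" for P
    using g by (auto simp: invariant_weight_def image_subset_iff)
  define I where "I = (\<integral>P. g P * indicator A (freq P 1) \<partial>M)"
  have term_eq: "(\<integral>P. g P * indicator A (asymp_freq (block_of P k)) \<partial>M) = I" if k: "1 \<le> k" for k
  proof -
    have "I = (\<integral>P. g P * indicator A (asymp_freq (block_of P 1)) \<partial>M)"
      unfolding I_def by (intro Bochner_Integration.integral_cong refl) (simp add: freq_eq block_1[unfolded One_nat_def])
    \<comment> \<open>Deleting \<open>k - 1\<close> times moves \<open>k\<close> to 1 and changes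
      neither \<open>g\<close> nor the frequency of the block.\<close>
    also have "\<dots> = (\<integral>P. g ((delete_first ^^ (k - 1)) P) *
        indicator A (asymp_freq (block_of ((delete_first ^^ (k - 1)) P) 1)) \<partial>M)"
      by (rule integral_funpow_T[symmetric]) measurable
    also have "\<dots> = (\<integral>P. g P * indicator A (asymp_freq (block_of P k)) \<partial>M)"
    proof (rule Bochner_Integration.integral_cong[OF refl])
      fix P assume "P \<in> space M"
      then have P: "P \<in> partitions" by simp
      have "block_of ((delete_first ^^ (k - 1)) P) 1 = tail_set (k - 1) (block_of P k)"
        using block_of_funpow_delete_first[OF P, of 1 "k - 1"] k by simp
      then show "g ((delete_first ^^ (k - 1)) P) *
          indicator A (asymp_freq (block_of ((delete_first ^^ (k - 1)) P) 1)) =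
          g P * (indicator A (asymp_freq (block_of P k)) :: real)"
        by (simp only: invariant_weight_funpow[OF g P] asymp_freq_tail_set)
    qed
    finally show ?thesis by simp
  qed
  define avg :: "nat \<Rightarrow> nat set set \<Rightarrow> real"
    where "avg n P = (\<Sum>k=1..n. indicator A (asymp_freq (block_of P k))) / real n" for n P
  have avg_card: "avg n P = real (card {k\<in>{1..n}. asymp_freq (block_of P k) \<in> A}) / real n" for n P
    by (simp add: avg_def indicator_def sum.If_cases Int_def)
  have avg01: "0 \<le> avg n P" "avg n P \<le> 1" for n P
  proof -
    have "card {k\<in>{1..n}. asymp_freq (block_of P k) \<in> A} \<le> card {1..n}" by (intro card_mono) auto
    then show "0 \<le> avg n P" "avg n P \<le> 1" unfolding avg_card by (cases "n = 0"; simp add: divide_le_eq_1)+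
  qed
  have [measurable]: "avg n \<in> borel_measurable M" for n unfolding avg_def by measurable
  \<comment> \<open>For \<open>n = 0\<close> the average is 0 by the convention on division, so the
    identity is used from \<open>n = 1\<close> on.\<close>
  have "(\<integral>P. g P * avg n P \<partial>M) = I" if n: "1 \<le> n" for n
  proof -
    have "(\<integral>P. g P * avg n P \<partial>M) =
        (\<integral>P. (\<Sum>k=1..n. g P * indicator A (asymp_freq (block_of P k))) / real n \<partial>M)"
      by (simp add: avg_def sum_distrib_left)
    also have "\<dots> = (\<Sum>k=1..n. (\<integral>P. g P * indicator A (asymp_freq (block_of P k)) \<partial>M)) / real n"
      using g01 by (subst Bochner_Integration.integral_divide_zero, subst Bochner_Integration.integral_sum)
        (auto intro!: integrable_const_bound[where B=1] simp: indicator_def)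
    also have "\<dots> = I" using n by (simp add: term_eq)
    finally show ?thesis .
  qed
  then have "(\<lambda>n. \<integral>P. g P * avg n P \<partial>M) \<longlonglongrightarrow> I"
    by (intro tendsto_eventually eventually_sequentiallyI[of 1])
  moreover have "(\<lambda>n. \<integral>P. g P * avg n P \<partial>M) \<longlonglongrightarrow> (\<integral>P. g P * measure (unordered_freq_dist P) A \<partial>M)"
  proof (rule integral_dominated_convergence[where w="\<lambda>_. 1"])
    show "(\<lambda>P. g P * measure (unordered_freq_dist P) A) \<in> borel_measurable M"
      using measurable_unordered_freq_dist_M[OF A] by measurable
    show "AE P in M. (\<lambda>n. g P * avg n P) \<longlonglongrightarrow> g P * measure (unordered_freq_dist P) A"
      using AE_convergent_block
    proof (rule AE_mp, intro AE_I2 impI)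
      fix P assume "P \<in> space M" "\<forall>i. convergent (rel_count (block P i))"
      then show "(\<lambda>n. g P * avg n P) \<longlonglongrightarrow> g P * measure (unordered_freq_dist P) A"
        unfolding avg_card by (intro tendsto_mult_left tendsto_card_large_freq[OF _ e A]) auto
    qed
    show "AE P in M. norm (g P * avg n P) \<le> 1" for n
      using g01 avg01 by (intro AE_I2) (simp add: abs_mult mult_le_one)
  qed (auto simp: integrable_const)
  ultimately show ?thesis unfolding I_def by (rule LIMSEQ_unique)
qed

text \<open>The sets \<open>B k\<close> are bounded away from 0 and increase to \<open>A\<close>, as
  0 is not in \<open>A\<close>; dominated convergence applies on both sides.\<close>

lemma integral_freq_1_pos:
  assumes g: "invariant_weight g" and A: "A \<in> sets unit_interval" and "0 \<notin> A"
  shows "(\<integral>P. g P * indicator A (freq P 1) \<partial>M) = (\<integral>P. g P * measure (unordered_freq_dist P) A \<partial>M)"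
proof -
  define B where "B k = A \<inter> {1 / real (Suc k)..}" for k
  have A01: "A \<subseteq> {0..1}" and A_borel [measurable]: "A \<in> sets borel"
    using A by (auto simp: sets_restrict_space_iff)
  have [measurable]: "B k \<in> sets borel" for k unfolding B_def by measurable
  have B: "B k \<in> sets unit_interval" for k
    using A01 \<open>B k \<in> sets borel\<close> by (auto simp: sets_restrict_space_iff B_def)
  have g_meas [measurable]: "g \<in> borel_measurable M" and g01: "0 \<le> g P" "g P \<le> 1" for P
    using g by (auto simp: invariant_weight_def image_subset_iff)
  have freq_meas [measurable]: "(\<lambda>P. freq P 1) \<in> borel_measurable M"
    using borel_measurable_freq[of 1] by (simp add: measurable_cong_sets[OF sets_M refl])
  have inc: "incseq B"
  proof (rule monoI)
    fix k l :: nat assume "k \<le> l"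
    then have "1 / real (Suc l) \<le> 1 / real (Suc k)" by (simp add: frac_le)
    then show "B k \<le> B l" unfolding B_def by auto
  qed
  have Un: "(\<Union>k. B k) = A"
  proof (intro equalityI subsetI)
    fix x assume x: "x \<in> A"
    then have "0 < x" using A01 \<open>0 \<notin> A\<close> by (metis atLeastAtMost_iff less_eq_real_def subsetD)
    then obtain k where "inverse (real (Suc k)) < x" using reals_Archimedean by blast
    then show "x \<in> (\<Union>k. B k)" using x by (intro UN_I[of k]) (auto simp: B_def inverse_eq_divide)
  qed (auto simp: B_def)
  have eq: "(\<integral>P. g P * indicator (B k) (freq P 1) \<partial>M) = (\<integral>P. g P * measure (unordered_freq_dist P) (B k) \<partial>M)" for k
  proof (rule integral_freq_1_large[OF g _ _ B])
    show "B k \<subseteq> {1 / real (Suc k)..1}" using A01 by (auto simp: B_def)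
  qed simp
  have "(\<lambda>k. \<integral>P. g P * indicator (B k) (freq P 1) \<partial>M) \<longlonglongrightarrow> (\<integral>P. g P * indicator A (freq P 1) \<partial>M)"
  proof (rule integral_dominated_convergence[where w="\<lambda>_. 1"])
    show "AE P in M. (\<lambda>k. g P * indicator (B k) (freq P 1)) \<longlonglongrightarrow> g P * indicator A (freq P 1)"
    proof (intro AE_I2 tendsto_mult_left)
      fix P
      show "(\<lambda>k. indicator (B k) (freq P 1) :: real) \<longlonglongrightarrow> indicator A (freq P 1)"
        using LIMSEQ_indicator_incseq[OF inc, where x="freq P 1"] unfolding Un .
    qed
    show "AE P in M. norm (g P * indicator (B k) (freq P 1)) \<le> 1" for k
      using g01 by (intro AE_I2) (simp add: indicator_def)
  qed (auto simp: integrable_const)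
  moreover have "(\<lambda>k. \<integral>P. g P * measure (unordered_freq_dist P) (B k) \<partial>M)
      \<longlonglongrightarrow> (\<integral>P. g P * measure (unordered_freq_dist P) A \<partial>M)"
  proof (rule integral_dominated_convergence[where w="\<lambda>_. 1"])
    show "AE P in M. (\<lambda>k. g P * measure (unordered_freq_dist P) (B k)) \<longlonglongrightarrow> g P * measure (unordered_freq_dist P) A"
    proof (intro AE_I2 tendsto_mult_left)
      fix P assume "P \<in> space M"
      then interpret nu: prob_space "unordered_freq_dist P" by (rule prob_space_freq_dist)
      show "(\<lambda>k. measure (unordered_freq_dist P) (B k)) \<longlonglongrightarrow> measure (unordered_freq_dist P) A"
        using nu.finite_Lim_measure_incseq[OF _ inc] B unfolding Un by (simp add: image_subset_iff)
    qed
    show "AE P in M. norm (g P * measure (unordered_freq_dist P) (B k)) \<le> 1" for k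
    proof (intro AE_I2)
      fix P assume "P \<in> space M"
      then interpret nu: prob_space "unordered_freq_dist P" by (rule prob_space_freq_dist)
      show "norm (g P * measure (unordered_freq_dist P) (B k)) \<le> 1"
        using g01 by (simp add: abs_mult mult_le_one)
    qed
  qed (use measurable_unordered_freq_dist_M[OF A] measurable_unordered_freq_dist_M[OF B] in
      \<open>auto simp: integrable_const intro!: borel_measurable_times g_meas\<close>)
  ultimately show ?thesis unfolding eq by (rule LIMSEQ_unique)
qed

text \<open>If \<open>A\<close> contains 0, its complement in [0,1] does not. On either side the
  values for \<open>A\<close> and for the complement add up to the integral of \<open>g\<close>,
  since \<open>freq P 1\<close> lies in [0,1] and the frequency distribution is a probability
  measure.\<close>

lemma integral_freq_1:
  assumes g: "invariant_weight g" and A: "A \<in> sets unit_interval"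
  shows "(\<integral>P. g P * indicator A (freq P 1) \<partial>M) = (\<integral>P. g P * measure (unordered_freq_dist P) A \<partial>M)"
proof (cases "0 \<in> A")
  case False
  then show ?thesis by (rule integral_freq_1_pos[OF g A])
next
  case True
  define B where "B = {0..1} - A"
  have B: "B \<in> sets unit_interval"
    using sets.compl_sets[OF A] by (simp add: B_def space_restrict_space)
  have A_borel [measurable]: "A \<in> sets borel" using A by (simp add: sets_restrict_space_iff)
  have [measurable]: "B \<in> sets borel" unfolding B_def by measurable
  have g_meas [measurable]: "g \<in> borel_measurable M" and g01: "0 \<le> g P" "g P \<le> 1" for P
    using g by (auto simp: invariant_weight_def image_subset_iff)
  have freq_meas [measurable]: "(\<lambda>P. freq P 1) \<in> borel_measurable M"
    using borel_measurable_freq[of 1] by (simp add: measurable_cong_sets[OF sets_M refl])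
  have int_g: "integrable M g"
    using g01 by (intro integrable_const_bound[where B=1]) auto
  have ind: "integrable M (\<lambda>P. g P * indicator B (freq P 1))"
    using g01 by (intro integrable_const_bound[where B=1]) (auto simp: indicator_def)
  have nu: "integrable M (\<lambda>P. g P * measure (unordered_freq_dist P) B)"
  proof (rule integrable_const_bound[where B=1])
    show "AE P in M. norm (g P * measure (unordered_freq_dist P) B) \<le> 1"
    proof (intro AE_I2)
      fix P assume "P \<in> space M"
      then interpret nu: prob_space "unordered_freq_dist P" by (rule prob_space_freq_dist)
      show "norm (g P * measure (unordered_freq_dist P) B) \<le> 1"
        using g01 by (simp add: abs_mult mult_le_one)
    qed
  qed (intro borel_measurable_times g_meas measurable_unordered_freq_dist_M[OF B])
  have "(\<integral>P. g P * indicator A (freq P 1) \<partial>M) = (\<integral>P. g P - g P * indicator B (freq P 1) \<partial>M)"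
    using freq_range by (intro Bochner_Integration.integral_cong refl) (auto simp: B_def indicator_def)
  also have "\<dots> = (\<integral>P. g P \<partial>M) - (\<integral>P. g P * indicator B (freq P 1) \<partial>M)"
    by (rule Bochner_Integration.integral_diff[OF int_g ind])
  also have "\<dots> = (\<integral>P. g P \<partial>M) - (\<integral>P. g P * measure (unordered_freq_dist P) B \<partial>M)"
    using True by (subst integral_freq_1_pos[OF g B]) (auto simp: B_def)
  also have "\<dots> = (\<integral>P. g P - g P * measure (unordered_freq_dist P) B \<partial>M)"
    by (rule Bochner_Integration.integral_diff[OF int_g nu, symmetric])
  also have "\<dots> = (\<integral>P. g P * measure (unordered_freq_dist P) A \<partial>M)"
  proof (intro Bochner_Integration.integral_cong refl)
    fix P assume "P \<in> space M"
    then interpret nu: prob_space "unordered_freq_dist P" by (rule prob_space_freq_dist)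
    have "space (unordered_freq_dist P) = {0..1}"
      using sets_eq_imp_space_eq[OF sets_unordered_freq_dist] by (simp add: space_restrict_space)
    then have compl: "measure (unordered_freq_dist P) B = 1 - measure (unordered_freq_dist P) A"
      using nu.prob_compl[of A] A by (simp add: B_def)
    show "g P - g P * measure (unordered_freq_dist P) B = g P * measure (unordered_freq_dist P) A"
      unfolding compl by (simp add: algebra_simps)
  qed
  finally show ?thesis .
qed

end

section \<open>Transfer from the law of the partition to the given probability space\<close>

theorem proposition5:
  fixes M :: "'w measure" and \<pi> :: "'w \<Rightarrow> nat set set"
  assumes "random_partition M \<pi>"
    and "stationary_partition M \<pi>"
  shows "(AE \<omega> in M. \<forall>i\<ge>1. rel_freq (\<pi> \<omega>) i \<longlonglongrightarrow> freq (\<pi> \<omega>) i) \<and>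
    conditionally_distributed M unit_interval
      (\<lambda>\<omega>. unordered_freq_dist (\<pi> \<omega>)) (\<lambda>\<omega>. freq (\<pi> \<omega>) 1)"
proof -
  interpret prob_space M using assms(1) by (simp add: random_partition_def)
  have \<pi> [measurable]: "\<pi> \<in> M \<rightarrow>\<^sub>M partition_space" using assms(1) by (simp add: random_partition_def)
  define N where "N = distr M partition_space \<pi>"
  have sets_N: "sets N = sets partition_space" by (simp add: N_def)
  \<comment> \<open>\<open>N\<close> and \<open>partition_space\<close> have the same measurable
    sets, so one may replace the other as the target of the push-forward.\<close>
  have "distr N N delete_first = distr N partition_space delete_first"
    by (rule distr_cong) (simp_all add: N_def)
  also have "\<dots> = distr M partition_space (\<lambda>\<omega>. delete_first (\<pi> \<omega>))"
    unfolding N_def by (subst distr_distr) (auto simp: comp_def)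
  also have "\<dots> = N" using assms(2) by (simp add: stationary_partition_def N_def)
  finally have "distr N N delete_first = N" .
  moreover have "delete_first \<in> N \<rightarrow>\<^sub>M N"
    using measurable_delete_first by (simp add: measurable_cong_sets[OF sets_N sets_N])
  ultimately interpret N: stationary_partition_system N
    using prob_space_distr[OF \<pi>] sets_N
    by (intro stationary_partition_system.intro stationary_system.intro
        stationary_system_axioms.intro stationary_partition_system_axioms.intro) (simp_all add: N_def)
  let ?\<nu> = "\<lambda>\<omega>. unordered_freq_dist (\<pi> \<omega>)"
  let ?F = "vimage_algebra (space M) ?\<nu> (prob_algebra unit_interval)"
  have "AE P in N. \<forall>i\<ge>1. rel_freq P i \<longlonglongrightarrow> freq P i"
    using N.AE_convergent_block by (rule AE_mp) (simp add: rel_freq_eq freq_eq convergent_asymp_freq)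
  then have frequencies: "AE \<omega> in M. \<forall>i\<ge>1. rel_freq (\<pi> \<omega>) i \<longlonglongrightarrow> freq (\<pi> \<omega>) i"
    unfolding N_def by (rule AE_distrD[OF \<pi>])
  have \<nu>: "?\<nu> \<in> M \<rightarrow>\<^sub>M prob_algebra unit_interval"
    by (rule measurable_compose[OF \<pi> measurable_unordered_freq_dist])
  have F1: "(\<lambda>\<omega>. freq (\<pi> \<omega>) 1) \<in> M \<rightarrow>\<^sub>M unit_interval"
    by (rule measurable_compose[OF \<pi> measurable_freq_unit_interval])
  \<comment> \<open>Measurability of the random measure makes the conditioning sigma-algebra a
    sub-sigma-algebra, as \<open>real_cond_exp\<close> requires.\<close>
  have "subalgebra M ?F"
    unfolding subalgebra_def using sets_image_in_sets[OF _ \<nu>] by simp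
  then interpret F: finite_measure_subalgebra M ?F by unfold_locales
  have "AE \<omega> in M. real_cond_exp M ?F (indicator ((\<lambda>\<omega>. freq (\<pi> \<omega>) 1) -` A \<inter> space M)) \<omega> = measure (?\<nu> \<omega>) A"
    if A: "A \<in> sets unit_interval" for A
  proof (rule F.real_cond_exp_charact)
    have [measurable]: "A \<in> sets borel" using A by (simp add: sets_restrict_space_iff)
    have event: "(\<lambda>\<omega>. freq (\<pi> \<omega>) 1) -` A \<inter> space M \<in> sets M" by (rule measurable_sets[OF F1 A])
    then show "integrable M (indicator ((\<lambda>\<omega>. freq (\<pi> \<omega>) 1) -` A \<inter> space M) :: 'w \<Rightarrow> real)"
      by (simp add: emeasure_eq_measure)
    have "?\<nu> \<in> ?F \<rightarrow>\<^sub>M prob_algebra unit_interval"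
      using measurable_space[OF \<nu>] by (intro measurable_vimage_algebra1) auto
    then show "(\<lambda>\<omega>. measure (?\<nu> \<omega>) A) \<in> borel_measurable ?F"
      by (rule measurable_compose[OF _ measurable_measure_prob_algebra[OF A]])
    have \<nu>A: "(\<lambda>\<omega>. measure (?\<nu> \<omega>) A) \<in> borel_measurable M"
      by (rule measurable_compose[OF \<nu> measurable_measure_prob_algebra[OF A]])
    show "integrable M (\<lambda>\<omega>. measure (?\<nu> \<omega>) A)"
    proof (rule integrable_const_bound[where B=1, OF AE_I2 \<nu>A])
      fix \<omega> assume "\<omega> \<in> space M"
      then have "prob_space (?\<nu> \<omega>)"
        using measurable_space[OF \<pi>] by (simp add: prob_space_unordered_freq_dist)
      then show "norm (measure (?\<nu> \<omega>) A) \<le> 1" by (simp add: prob_space.prob_le_1)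
    qed
    fix X assume "X \<in> sets ?F"
    then obtain Y where Y: "Y \<in> sets (prob_algebra unit_interval)" and X: "X = ?\<nu> -` Y \<inter> space M"
      using measurable_space[OF \<nu>] by (auto simp: sets_vimage_algebra2)
    \<comment> \<open>On the sample space, the indicator of \<open>X\<close> is \<open>g\<close>
      composed with the random partition. It depends on the partition only through the frequency
      distribution, whence its invariance under deletion.\<close>
    define g where "g P = (indicator Y (unordered_freq_dist P) :: real)" for P
    have g [measurable]: "g \<in> borel_measurable partition_space"
      unfolding g_def using Y by measurable
    have "N.invariant_weight g"
      unfolding N.invariant_weight_def
    proof (intro conjI ballI)
      show "g \<in> borel_measurable N" using g by (simp add: N_def)
      show "g (delete_first P) = g P" if "P \<in> partitions" for P
        by (simp add: g_def unordered_freq_dist_delete_first[OF that])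
    qed (auto simp: g_def indicator_def)
    note N.integral_freq_1[OF this A]
    moreover have "(\<integral>P. g P * indicator A (freq P 1) \<partial>N) = (\<integral>\<omega>. g (\<pi> \<omega>) * indicator A (freq (\<pi> \<omega>) 1) \<partial>M)"
      unfolding N_def by (rule integral_distr[OF \<pi>]) measurable
    moreover have "(\<integral>P. g P * measure (unordered_freq_dist P) A \<partial>N) = (\<integral>\<omega>. g (\<pi> \<omega>) * measure (?\<nu> \<omega>) A \<partial>M)"
      unfolding N_def
      by (rule integral_distr[OF \<pi>], rule borel_measurable_times[OF g],
          rule measurable_compose[OF measurable_unordered_freq_dist measurable_measure_prob_algebra[OF A]])
    ultimately have "(\<integral>\<omega>. g (\<pi> \<omega>) * indicator A (freq (\<pi> \<omega>) 1) \<partial>M) = (\<integral>\<omega>. g (\<pi> \<omega>) * measure (?\<nu> \<omega>) A \<partial>M)"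
      by simp
    moreover have "(\<integral>\<omega>\<in>X. indicator ((\<lambda>\<omega>. freq (\<pi> \<omega>) 1) -` A \<inter> space M) \<omega> \<partial>M) =
        (\<integral>\<omega>. g (\<pi> \<omega>) * indicator A (freq (\<pi> \<omega>) 1) \<partial>M)"
      unfolding set_lebesgue_integral_def
      by (intro Bochner_Integration.integral_cong refl) (auto simp: X g_def indicator_def)
    moreover have "(\<integral>\<omega>\<in>X. measure (?\<nu> \<omega>) A \<partial>M) = (\<integral>\<omega>. g (\<pi> \<omega>) * measure (?\<nu> \<omega>) A \<partial>M)"
      unfolding set_lebesgue_integral_def
      by (intro Bochner_Integration.integral_cong refl) (auto simp: X g_def indicator_def)
    ultimately show "(\<integral>\<omega>\<in>X. indicator ((\<lambda>\<omega>. freq (\<pi> \<omega>) 1) -` A \<inter> space M) \<omega> \<partial>M) =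
        (\<integral>\<omega>\<in>X. measure (?\<nu> \<omega>) A \<partial>M)"
      by simp
  qed
  with frequencies \<nu> F1 show ?thesis by (simp add: conditionally_distributed_def)
qed

end
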